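(* Let $(\mathfrak{g},[\cdot,\cdot],s,\alpha)$ be a Hom-Lie superalgebra in characteristic $2$ and $(M,\beta)$ a $\mathfrak{g}$-module. For all $n\ge1$, we have $\mathfrak{d}^n_\alpha\circ\mathfrak{d}^{n-1}_\alpha=0$. Hence the pair $(XC^*_\alpha(\mathfrak{g};M),\mathfrak{d}^*_\alpha)$ defines a cohomology complex for Hom-Lie superalgebras in characteristic $2$.
   Context: All vector spaces are over a field $\mathbb{K}$ of characteristic $2$. Hom-Lie superalgebra in characteristic 2: a quadruple $(\mathfrak{g},[\cdot,\cdot],s,\alpha)$ with $\mathfrak{g}=\mathfrak{g}_{\bar 0}\oplus\mathfrak{g}_{\bar 1}$ a superspace, $[\cdot,\cdot]$ a symmetric bilinear bracket, $s:\mathfrak{g}_{\bar 1}\to\mathfrak{g}_{\bar 0}$ with $s(\lambda x)=\lambda^2s(x)$, $\alpha\in\mathrm{End}(\mathfrak{g})$ even, such that (i) on $\mathfrak{g}_{\bar 0}$: $[x,x]=0$, $\alpha([x,y])=[\alpha(x),\alpha(y)]$ and $[\alpha(x),[y,z]]+[\alpha(y),[z,x]]+[\alpha(z),[x,y]]=0$; (ii) $\mathfrak{g}_{\bar 1}$ is a $\mathfrak{g}_{\bar 0}$-module via the bracket (made two-sided by symmetry): $[\alpha(x),\alpha(v)]=\alpha([x,v])$ and $[[x,y],\alpha(v)]=[\alpha(x),[y,v]]+[\alpha(y),[x,v]]$ for $x,y\in\mathfrak{g}_{\bar 0}$, $v\in\mathfrak{g}_{\bar 1}$; (iii) $(x,y)\mapsto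 s(x+y)+s(x)+s(y)$ on $\mathfrak{g}_{\bar 1}\times\mathfrak{g}_{\bar 1}$ is bilinear and equals $[x,y]$; (iv) $[s(x),\alpha(y)]=[\alpha(x),[x,y]]$ for $x\in\mathfrak{g}_{\bar 1}$, $y\in\mathfrak{g}$; $\alpha([x,y])=[\alpha(x),\alpha(y)]$ for $x,y\in\mathfrak{g}$; $\alpha(s(x))=s(\alpha(x))$ for $x\in\mathfrak{g}_{\bar 1}$. $\mathfrak{g}$-module $(M,\beta)$: a superspace $M$, $\beta\in\mathfrak{gl}(M)$ even, and an even bilinear action $x\cdot m$ of $\mathfrak{g}$ on $M$ with $\alpha(x)\cdot\beta(m)=\beta(x\cdot m)$, $[x,y]\cdot\beta(m)=\alpha(x)\cdot(y\cdot m)+\alpha(y)\cdot(x\cdot m)$ for $x,y\in\mathfrak{g}$, and $s(x)\cdot\beta(m)=\alpha(x)\cdot(x\cdot m)$ for $x\in\mathfrak{g}_{\bar 1}$. Cochains: $XC^{-1}_\alpha:=\{0\}$; $XC^0_\alpha(\mathfrak{g};M):=\{m\in M\mid\beta(m)=m,\ \alpha(x)\cdot(y\cdot m)=x\cdot(y\cdot m)\ \forall x,y\in\mathfrak{g}\}$; $XC^1_\alpha(\mathfrak{g};M)$: linear maps $c:\mathfrak{g}\to M$ with $\beta\circ c=c\circ\alpha$. For $n\ge2$: pairs $(c,\mathfrak{p})$ with $c:\wedge^n\mathfrak{g}\to M$ multilinear (alternating $n$-linear), $\mathfrak{p}:\mathfrak{g}_{\bar 1}\times\wedge^{n-2}\mathfrak{g}\to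 M$ with $\mathfrak{p}(\lambda x,z)=\lambda^2\mathfrak{p}(x,z)$ and $z\mapsto\mathfrak{p}(x,z)$ multilinear, such that $\beta\circ c=c\circ(\alpha\wedge\cdots\wedge\alpha)$, $\beta\circ\mathfrak{p}=\mathfrak{p}\circ(\alpha\wedge\cdots\wedge\alpha)$ ($\alpha$ applied to every argument), and $\mathfrak{p}(x+y,z)+\mathfrak{p}(x,z)+\mathfrak{p}(y,z)=c(x,y,z)$ for $x,y\in\mathfrak{g}_{\bar 1}$, $z\in\wedge^{n-2}\mathfrak{g}$. Differentials $\mathfrak{d}^n_\alpha:XC^n_\alpha(\mathfrak{g};M)\to XC^{n+1}_\alpha(\mathfrak{g};M)$ (hats denote omission): $\mathfrak{d}^0_\alpha(m)(x)=x\cdot m$; $\mathfrak{d}^1_\alpha(c)=(d^1_\alpha c,\mathfrak{q})$ with $d^1_\alpha c(x,z)=c([x,z])+x\cdot c(z)+z\cdot c(x)$ and $\mathfrak{q}(x)=c(s(x))+x\cdot c(x)$ for $x\in\mathfrak{g}_{\bar 1}$; for $n\ge2$, $\mathfrak{d}^n_\alpha(c,\mathfrak{p})=(d^n_\alpha c,d^n_\alpha\mathfrak{p})$ with $$d^n_\alpha c(z_1,\dots,z_{n+1})=\sum_{1\le i\le n+1}\alpha^{n-1}(z_i)\cdot c(z_1,\dots,\hat z_i,\dots,z_{n+1})+\sum_{1\le i<j\le n+1}c([z_i,z_j],\alpha(z_1),\dots,\hat z_i,\dots,\hat z_j,\dots,\alpha(z_{n+1})),$$ $$d^n_\alpha\mathfrak{p}(x,z_1,\dots,z_{n-1})=\alpha^{n-1}(x)\cdot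 c(x,z_1,\dots,z_{n-1})+c(s(x),\alpha(z_1),\dots,\alpha(z_{n-1}))+\sum_{1\le i\le n-1}\alpha^{n-1}(z_i)\cdot\mathfrak{p}(x,z_1,\dots,\hat z_i,\dots,z_{n-1})$$ $$+\sum_{1\le i\le n-1}c([x,z_i],\alpha(x),\alpha(z_1),\dots,\hat z_i,\dots,\alpha(z_{n-1}))+\sum_{1\le i<j\le n-1}\mathfrak{p}(\alpha(x),[z_i,z_j],\alpha(z_1),\dots,\hat z_i,\dots,\hat z_j,\dots,\alpha(z_{n-1})).$$ *)

theory Defs
  imports Complex_Main "HOL-Library.Z2" "HOL-Library.Function_Algebras" "HOL-Library.Product_Plus"
begin

text \<open>Degrees are elements of \<open>\<int>/2\<close>, i.e. of the type \<^typ>\<open>bit\<close>: \<open>V 0\<close> is the even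
  and \<open>V 1\<close> the odd part.\<close>

locale superspace = vector_space scale
  for scale :: "'k::field \<Rightarrow> 'v::ab_group_add \<Rightarrow> 'v" +
  fixes V :: "bit \<Rightarrow> 'v set"
  assumes subspace_parts: "subspace (V i)"
    and parts_span: "\<exists>x0 x1. x0 \<in> V 0 \<and> x1 \<in> V 1 \<and> v = x0 + x1"
    and parts_disjoint: "V 0 \<inter> V 1 = {0}"

definition even_map :: "(bit \<Rightarrow> 'v set) \<Rightarrow> (bit \<Rightarrow> 'w set) \<Rightarrow> ('v \<Rightarrow> 'w) \<Rightarrow> bool" where
  "even_map V W f \<longleftrightarrow> (\<forall>i. \<forall>x \<in> V i. f x \<in> W i)"

definition even_map2 ::
    "(bit \<Rightarrow> 'u set) \<Rightarrow> (bit \<Rightarrow> 'v set) \<Rightarrow> (bit \<Rightarrow> 'w set) \<Rightarrow> ('u \<Rightarrow> 'v \<Rightarrow> 'w) \<Rightarrow> bool" where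
  "even_map2 U V W f \<longleftrightarrow> (\<forall>i j. \<forall>x \<in> U i. \<forall>y \<in> V j. f x y \<in> W (i + j))"

definition bilinear_map ::
    "('k::field \<Rightarrow> 'u::ab_group_add \<Rightarrow> 'u) \<Rightarrow> ('k \<Rightarrow> 'v::ab_group_add \<Rightarrow> 'v) \<Rightarrow>
     ('k \<Rightarrow> 'w::ab_group_add \<Rightarrow> 'w) \<Rightarrow> ('u \<Rightarrow> 'v \<Rightarrow> 'w) \<Rightarrow> bool" where
  "bilinear_map su sv sw f \<longleftrightarrow>
     (\<forall>x. Vector_Spaces.linear sv sw (\<lambda>y. f x y)) \<and>
     (\<forall>y. Vector_Spaces.linear su sw (\<lambda>x. f x y))"

text \<open>The squaring \<open>s\<close> is a total function of which only the restriction to \<open>G 1\<close> is relevant.\<close>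

locale hom_lie_superalgebra_char2 = superspace sg G
  for sg :: "'k::field \<Rightarrow> 'g::ab_group_add \<Rightarrow> 'g"
    and G :: "bit \<Rightarrow> 'g set" +
  fixes br :: "'g \<Rightarrow> 'g \<Rightarrow> 'g"
    and s :: "'g \<Rightarrow> 'g"
    and \<alpha> :: "'g \<Rightarrow> 'g"
  assumes char2: "CHAR('k) = 2"
    and br_bilinear: "bilinear_map sg sg sg br"
    and br_even: "even_map2 G G G br"
    and br_sym: "br x y = br y x"
    and s_mem: "x \<in> G 1 \<Longrightarrow> s x \<in> G 0"
    and s_scale: "x \<in> G 1 \<Longrightarrow> s (sg a x) = sg (a\<^sup>2) (s x)"
    and \<alpha>_linear: "Vector_Spaces.linear sg sg \<alpha>"
    and \<alpha>_even: "even_map G G \<alpha>"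
    \<comment> \<open>\<open>G 0\<close> is a Hom-Lie algebra\<close>
    and br_even_self: "x \<in> G 0 \<Longrightarrow> br x x = 0"
    and br_even_mult: "x \<in> G 0 \<Longrightarrow> y \<in> G 0 \<Longrightarrow> \<alpha> (br x y) = br (\<alpha> x) (\<alpha> y)"
    and hom_jacobi: "x \<in> G 0 \<Longrightarrow> y \<in> G 0 \<Longrightarrow> z \<in> G 0 \<Longrightarrow>
          br (\<alpha> x) (br y z) + br (\<alpha> y) (br z x) + br (\<alpha> z) (br x y) = 0"
    \<comment> \<open>\<open>G 1\<close> is a module over \<open>G 0\<close>\<close>
    and odd_module_mult: "x \<in> G 0 \<Longrightarrow> v \<in> G 1 \<Longrightarrow> br (\<alpha> x) (\<alpha> v) = \<alpha> (br x v)"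
    and odd_module: "x \<in> G 0 \<Longrightarrow> y \<in> G 0 \<Longrightarrow> v \<in> G 1 \<Longrightarrow>
          br (br x y) (\<alpha> v) = br (\<alpha> x) (br y v) + br (\<alpha> y) (br x v)"
    and s_polar: "x \<in> G 1 \<Longrightarrow> y \<in> G 1 \<Longrightarrow> s (x + y) + s x + s y = br x y"
    and s_jacobi: "x \<in> G 1 \<Longrightarrow> br (s x) (\<alpha> y) = br (\<alpha> x) (br x y)"
    and \<alpha>_mult: "\<alpha> (br x y) = br (\<alpha> x) (\<alpha> y)"
    and \<alpha>_s: "x \<in> G 1 \<Longrightarrow> \<alpha> (s x) = s (\<alpha> x)"

text \<open>Alternating \<open>n\<close>-linear maps are represented by functions on lists, set to \<open>0\<close> on lists of
  length different from \<open>n\<close> so that equal maps are equal as HOL functions. For \<open>n = 0\<close> these are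
  the elements of the target space.\<close>

definition alternating_map ::
    "('k::field \<Rightarrow> 'v::ab_group_add \<Rightarrow> 'v) \<Rightarrow> ('k \<Rightarrow> 'w::ab_group_add \<Rightarrow> 'w) \<Rightarrow> nat \<Rightarrow>
     ('v list \<Rightarrow> 'w) \<Rightarrow> bool" where
  "alternating_map sv sw n f \<longleftrightarrow>
     (\<forall>zs. length zs \<noteq> n \<longrightarrow> f zs = 0) \<and>
     (\<forall>zs. \<forall>i<n. length zs = n \<longrightarrow> Vector_Spaces.linear sv sw (\<lambda>x. f (zs[i := x]))) \<and>
     (\<forall>zs. length zs = n \<longrightarrow> \<not> distinct zs \<longrightarrow> f zs = 0)"

text \<open>\<open>omit I zs\<close> removes the entries of \<open>zs\<close> at the (zero-based) positions in \<open>I\<close>; it renders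
  the hats.\<close>

definition omit :: "nat set \<Rightarrow> 'a list \<Rightarrow> 'a list" where
  "omit I zs = nths zs (- I)"

text \<open>Cochains of all degrees live in one type of pairs \<open>(c, p)\<close>. An element \<open>m\<close> of \<open>M\<close> is
  identified with \<open>c\<close> supported on the empty list, a linear map with \<open>c\<close> supported on lists of
  length \<open>1\<close>, both with \<open>p = 0\<close>. In degree \<open>n \<ge> 2\<close>, \<open>p x zs\<close> is set to \<open>0\<close> unless \<open>x\<close> is odd and
  \<open>zs\<close> has length \<open>n - 2\<close>. Addition is pointwise.\<close>

type_synonym ('g, 'm) cochain = "('g list \<Rightarrow> 'm) \<times> ('g \<Rightarrow> 'g list \<Rightarrow> 'm)"

definition scale_cochain ::
    "('k \<Rightarrow> 'm \<Rightarrow> 'm) \<Rightarrow> 'k \<Rightarrow> ('g, 'm) cochain \<Rightarrow> ('g, 'm) cochain" where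
  "scale_cochain sm a f = (\<lambda>zs. sm a (fst f zs), \<lambda>x zs. sm a (snd f x zs))"

definition cochain0 :: "'m::zero \<Rightarrow> ('g, 'm) cochain" where
  "cochain0 m = (\<lambda>zs. if zs = [] then m else 0, 0)"

definition cochain1 :: "('g \<Rightarrow> 'm::zero) \<Rightarrow> ('g, 'm) cochain" where
  "cochain1 c = (\<lambda>zs. if length zs = 1 then c (zs ! 0) else 0, 0)"

locale hom_lie_module_char2 =
  hom_lie_superalgebra_char2 sg G br s \<alpha> + M: superspace sm M
  for sg :: "'k::field \<Rightarrow> 'g::ab_group_add \<Rightarrow> 'g"
    and G :: "bit \<Rightarrow> 'g set"
    and br :: "'g \<Rightarrow> 'g \<Rightarrow> 'g"
    and s :: "'g \<Rightarrow> 'g"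
    and \<alpha> :: "'g \<Rightarrow> 'g"
    and sm :: "'k \<Rightarrow> 'm::ab_group_add \<Rightarrow> 'm"
    and M :: "bit \<Rightarrow> 'm set" +
  fixes act :: "'g \<Rightarrow> 'm \<Rightarrow> 'm" (infixr \<open>\<bullet>\<close> 75)
    and \<beta> :: "'m \<Rightarrow> 'm"
  assumes \<beta>_linear: "Vector_Spaces.linear sm sm \<beta>"
    and \<beta>_even: "even_map M M \<beta>"
    and act_bilinear: "bilinear_map sg sm sm act"
    and act_even: "even_map2 G M M act"
    and act_mult: "\<alpha> x \<bullet> \<beta> m = \<beta> (x \<bullet> m)"
    and act_br: "br x y \<bullet> \<beta> m = \<alpha> x \<bullet> y \<bullet> m + \<alpha> y \<bullet> x \<bullet> m"
    and act_s: "x \<in> G 1 \<Longrightarrow> s x \<bullet> \<beta> m = \<alpha> x \<bullet> x \<bullet> m"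
begin

definition XC0 :: "'m set" where
  "XC0 = {m. \<beta> m = m \<and> (\<forall>x y. \<alpha> x \<bullet> y \<bullet> m = x \<bullet> y \<bullet> m)}"

definition XC1 :: "('g \<Rightarrow> 'm) set" where
  "XC1 = {c. Vector_Spaces.linear sg sm c \<and> \<beta> \<circ> c = c \<circ> \<alpha>}"

definition XC_ge2 :: "nat \<Rightarrow> ('g, 'm) cochain set" where
  "XC_ge2 n = {(c, p).
     alternating_map sg sm n c \<and>
     (\<forall>x. x \<notin> G 1 \<longrightarrow> p x = 0) \<and>
     (\<forall>x \<in> G 1. alternating_map sg sm (n - 2) (p x)) \<and>
     (\<forall>x \<in> G 1. \<forall>a zs. p (sg a x) zs = sm (a\<^sup>2) (p x zs)) \<and>
     (\<forall>zs. length zs = n \<longrightarrow> \<beta> (c zs) = c (map \<alpha> zs)) \<and>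
     (\<forall>x \<in> G 1. \<forall>zs. length zs = n - 2 \<longrightarrow> \<beta> (p x zs) = p (\<alpha> x) (map \<alpha> zs)) \<and>
     (\<forall>x \<in> G 1. \<forall>y \<in> G 1. \<forall>zs. length zs = n - 2 \<longrightarrow>
        p (x + y) zs + p x zs + p y zs = c (x # y # zs))}"

definition XC :: "int \<Rightarrow> ('g, 'm) cochain set" where
  "XC n = (if n < 0 then {0}
           else if n = 0 then cochain0 ` XC0
           else if n = 1 then cochain1 ` XC1
           else XC_ge2 (nat n))"

definition d0 :: "'m \<Rightarrow> 'g \<Rightarrow> 'm" where
  "d0 m = (\<lambda>x. x \<bullet> m)"

definition d1 :: "('g \<Rightarrow> 'm) \<Rightarrow> ('g, 'm) cochain" where
  "d1 c =
     (\<lambda>zs. if length zs = 2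
           then c (br (zs ! 0) (zs ! 1)) + zs ! 0 \<bullet> c (zs ! 1) + zs ! 1 \<bullet> c (zs ! 0)
           else 0,
      \<lambda>x zs. if x \<in> G 1 \<and> zs = [] then c (s x) + x \<bullet> c x else 0)"

definition d_ge2 :: "nat \<Rightarrow> ('g, 'm) cochain \<Rightarrow> ('g, 'm) cochain" where
  "d_ge2 n = (\<lambda>(c, p).
     (\<lambda>zs. if length zs = n + 1
           then (\<Sum>i<n+1. (\<alpha> ^^ (n - 1)) (zs ! i) \<bullet> c (omit {i} zs))
              + (\<Sum>j<n+1. \<Sum>i<j. c (br (zs ! i) (zs ! j) # map \<alpha> (omit {i, j} zs)))
           else 0,
      \<lambda>x zs. if x \<in> G 1 \<and> length zs = n - 1
           then (\<alpha> ^^ (n - 1)) x \<bullet> c (x # zs)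
              + c (s x # map \<alpha> zs)
              + (\<Sum>i<n-1. (\<alpha> ^^ (n - 1)) (zs ! i) \<bullet> p x (omit {i} zs))
              + (\<Sum>i<n-1. c (br x (zs ! i) # \<alpha> x # map \<alpha> (omit {i} zs)))
              + (\<Sum>j<n-1. \<Sum>i<j. p (\<alpha> x) (br (zs ! i) (zs ! j) # map \<alpha> (omit {i, j} zs)))
           else 0))"

definition d :: "int \<Rightarrow> ('g, 'm) cochain \<Rightarrow> ('g, 'm) cochain" where
  "d n f = (if n < 0 then 0
            else if n = 0 then cochain1 (d0 (fst f []))
            else if n = 1 then d1 (\<lambda>x. fst f [x])
            else d_ge2 (nat n) f)"

end

locale cochain_complex = vector_space scale
  for scale :: "'k::field \<Rightarrow> 'v::ab_group_add \<Rightarrow> 'v" +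
  fixes C :: "int \<Rightarrow> 'v set"
    and \<delta> :: "int \<Rightarrow> 'v \<Rightarrow> 'v"
  assumes subspace_C: "subspace (C n)"
    and \<delta>_mem: "f \<in> C n \<Longrightarrow> \<delta> n f \<in> C (n + 1)"
    and \<delta>_add: "f \<in> C n \<Longrightarrow> g \<in> C n \<Longrightarrow> \<delta> n (f + g) = \<delta> n f + \<delta> n g"
    and \<delta>_scale: "f \<in> C n \<Longrightarrow> \<delta> n (scale a f) = scale a (\<delta> n f)"
    and \<delta>_\<delta>: "f \<in> C n \<Longrightarrow> \<delta> (n + 1) (\<delta> n f) = 0"

end

theory Submission
  imports Defs "HOL-Library.Multiset"
begin

text \<open>In characteristic 2 no signs occur and an alternating map does not see the order of its
  arguments. Expanding the square of the differential therefore gives sums over choices of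
  disjoint single entries and pairs of entries of one list \<open>zs\<close>, and every summand either meets an
  equal one or is part of an identity of the algebra or of the module. For the component \<open>c\<close>
  (\<open>diff_c_squared\<close>):

  \<^item> two actions in a row, over both orders of two entries, add up to the action of a bracket;
  \<^item> an action outside a bracket inside equals a bracket outside an action inside;
  \<^item> two brackets on disjoint pairs occur in both orders and cancel;
  \<^item> nested brackets form Jacobi sums.

  For the component \<open>p\<close> (\<open>diff_p_squared\<close>) one may think of \<open>p(x, z)\<close> as half of
  \<open>c(x, x, z)\<close>, just as \<open>s(x)\<close> stands for half of \<open>[x, x]\<close>. The same cancellations occur, and the
  identities \<open>[s(x), \<alpha>(y)] = [\<alpha>(x), [x, y]]\<close> and \<open>s(x) \<bullet> \<beta>(m) = \<alpha>(x) \<bullet> x \<bullet> m\<close>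
  cancel the terms in which \<open>x\<close> would meet itself. Both computations need the Jacobi
  identity for all of \<open>\<gg>\<close> (\<open>hom_jacobi_all\<close>); the axioms have it for even arguments and for two
  even and one odd argument, and polarizing the axiom for \<open>s\<close> supplies the other parities.

  That the differential maps cochains to cochains is checked on the first entries of a list only,
  because alternating maps are permutation invariant. The compatibility of \<open>p\<close> with \<open>c\<close> is
  preserved because replacing \<open>x\<close> by \<open>x + y\<close> in the formula for \<open>p\<close> produces, up to
  terms that occur twice, the formula for \<open>c\<close> at \<open>x\<close> and \<open>y\<close> (\<open>diff_p_add\<close>). In degree 0 the
  differential has a different form; there the square vanishes by the conditions that define the cochains of degree 0
  (\<open>d_d_0\<close>).\<close>

section \<open>Sums over entries and over pairs of entries of a list\<close>

text \<open>The differential sums over positions and over pairs of positions of a list, and its square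
  has such sums inside each other. Recursion on the list hands every summand the chosen entries and
  the list of the others, so that nested sums never need a renumbering of positions.\<close>

fun pick_sum :: "('a \<Rightarrow> 'a list \<Rightarrow> 'b::comm_monoid_add) \<Rightarrow> 'a list \<Rightarrow> 'b" where
  "pick_sum F [] = 0"
| "pick_sum F (z # zs) = F z zs + pick_sum (\<lambda>w ws. F w (z # ws)) zs"

fun pick2_sum :: "('a \<Rightarrow> 'a \<Rightarrow> 'a list \<Rightarrow> 'b::comm_monoid_add) \<Rightarrow> 'a list \<Rightarrow> 'b" where
  "pick2_sum F [] = 0"
| "pick2_sum F (z # zs) = pick_sum (F z) zs + pick2_sum (\<lambda>a b ws. F a b (z # ws)) zs"

lemma omit_Cons:
  "omit I (z # zs) = (if 0 \<in> I then [] else [z]) @ omit {j. Suc j \<in> I} zs"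
proof -
  have "{j. Suc j \<in> - I} = - {j. Suc j \<in> I}"
    by auto
  then show ?thesis
    by (simp add: omit_def nths_Cons)
qed

lemma omit_empty: "omit {} zs = zs"
  by (simp add: omit_def nths_all)

lemma sum_omit_eq_pick_sum:
  "(\<Sum>i<length zs. F (zs ! i) (omit {i} zs)) = pick_sum F zs"
proof (induction zs arbitrary: F)
  case (Cons z zs)
  have [simp]: "{j. j = i} = {i}" for i :: nat
    by auto
  show ?case
    using Cons.IH[of "\<lambda>w ws. F w (z # ws)"]
    by (simp add: sum.lessThan_Suc_shift omit_Cons omit_empty del: sum.lessThan_Suc)
qed simp

lemma sum_omit2_eq_pick2_sum:
  "(\<Sum>j<length zs. \<Sum>i<j. F (zs ! i) (zs ! j) (omit {i, j} zs)) = pick2_sum F zs"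
proof (induction zs arbitrary: F)
  case (Cons z zs)
  have [simp]: "{j. j = i} = {i}" "{k. k = i \<or> k = j} = {i, j}" for i j :: nat
    by auto
  show ?case
    using Cons.IH[of "\<lambda>a b ws. F a b (z # ws)"] sum_omit_eq_pick_sum[of "F z" zs]
    by (simp add: sum.lessThan_Suc_shift omit_Cons omit_empty sum.distrib del: sum.lessThan_Suc)
qed simp

lemma pick_sum_0: "pick_sum (\<lambda>z ws. 0) zs = 0"
  by (induction zs) auto

lemma pick2_sum_0: "pick2_sum (\<lambda>a b ws. 0) zs = 0"
  by (induction zs) (auto simp: pick_sum_0)

lemma pick_sum_cong:
  assumes "\<And>z ws. length zs = Suc (length ws) \<Longrightarrow> F z ws = H z ws"
  shows "pick_sum F zs = pick_sum H zs"
  using assms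
proof (induction zs arbitrary: F H)
  case (Cons z zs)
  have "pick_sum (\<lambda>w ws. F w (z # ws)) zs = pick_sum (\<lambda>w ws. H w (z # ws)) zs"
    by (rule Cons.IH) (simp add: Cons.prems)
  then show ?case
    by (simp add: Cons.prems)
qed simp

lemma pick2_sum_cong:
  assumes "\<And>a b ws. length zs = Suc (Suc (length ws)) \<Longrightarrow> F a b ws = H a b ws"
  shows "pick2_sum F zs = pick2_sum H zs"
  using assms
proof (induction zs arbitrary: F H)
  case (Cons z zs)
  have "pick2_sum (\<lambda>a b ws. F a b (z # ws)) zs = pick2_sum (\<lambda>a b ws. H a b (z # ws)) zs"
    by (rule Cons.IH) (simp add: Cons.prems)
  moreover have "pick_sum (F z) zs = pick_sum (H z) zs"
    by (rule pick_sum_cong) (simp add: Cons.prems)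
  ultimately show ?case
    by simp
qed simp

lemma pick_sum_eq_0:
  assumes "\<And>z ws. length zs = Suc (length ws) \<Longrightarrow> F z ws = 0"
  shows "pick_sum F zs = 0"
  using pick_sum_cong[of zs F "\<lambda>z ws. 0"] assms by (simp add: pick_sum_0)

lemma pick2_sum_eq_0:
  assumes "\<And>a b ws. length zs = Suc (Suc (length ws)) \<Longrightarrow> F a b ws = 0"
  shows "pick2_sum F zs = 0"
  using pick2_sum_cong[of zs F "\<lambda>a b ws. 0"] assms by (simp add: pick2_sum_0)

lemma pick_sum_add:
  "pick_sum (\<lambda>z ws. F z ws + H z ws) zs = pick_sum F zs + pick_sum H zs"
  by (induction zs arbitrary: F H) (auto simp: ac_simps)

lemma pick2_sum_add:
  "pick2_sum (\<lambda>a b ws. F a b ws + H a b ws) zs = pick2_sum F zs + pick2_sum H zs"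
  by (induction zs arbitrary: F H) (auto simp: ac_simps pick_sum_add)

lemma pick_sum_hom:
  assumes "\<And>x y. h (x + y) = h x + h y" "h 0 = 0"
  shows "h (pick_sum F zs) = pick_sum (\<lambda>z ws. h (F z ws)) zs"
  by (induction zs arbitrary: F) (auto simp: assms)

lemma pick2_sum_hom:
  assumes "\<And>x y. h (x + y) = h x + h y" "h 0 = 0"
  shows "h (pick2_sum F zs) = pick2_sum (\<lambda>a b ws. h (F a b ws)) zs"
  by (induction zs arbitrary: F) (auto simp: assms pick_sum_hom[of h])

lemma pick_sum_map:
  "pick_sum F (map f zs) = pick_sum (\<lambda>z ws. F (f z) (map f ws)) zs"
  by (induction zs arbitrary: F) auto

lemma pick2_sum_map:
  "pick2_sum F (map f zs) = pick2_sum (\<lambda>a b ws. F (f a) (f b) (map f ws)) zs"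
  by (induction zs arbitrary: F) (auto simp: pick_sum_map)

lemma pick_sum_pick_sum:
  "pick_sum (\<lambda>z. pick_sum (F z)) zs = pick2_sum (\<lambda>a b ws. F a b ws + F b a ws) zs"
  by (induction zs arbitrary: F) (auto simp: pick_sum_add ac_simps)

lemma pick_sum_pick_sum_swap:
  "pick_sum (\<lambda>z. pick_sum (F z)) zs = pick_sum (\<lambda>z. pick_sum (\<lambda>w. F w z)) zs"
  by (simp add: pick_sum_pick_sum add.commute)

lemma pick_sum_pick2_sum:
  "pick_sum (\<lambda>z. pick2_sum (F z)) zs = pick2_sum (\<lambda>a b. pick_sum (\<lambda>z. F z a b)) zs"
proof (induction zs arbitrary: F)
  case (Cons z zs)
  show ?case
    using Cons.IH[of "\<lambda>w a b ws. F w a b (z # ws)"]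
      pick_sum_pick_sum_swap[of "\<lambda>w a. F w z a" zs]
    by (simp add: pick_sum_add pick2_sum_add ac_simps)
qed simp

text \<open>The sum runs over the ways to split three entries into a pair and a single entry; grouped by
  the underlying triple, it has the three cyclic terms of a Jacobi identity.\<close>

lemma pick2_sum_pick_sum_jacobi:
  assumes "\<And>a b c ws. F a b c ws + F a c b ws + F b c a ws = 0"
  shows "pick2_sum (\<lambda>a b. pick_sum (F a b)) zs = 0"
  using assms
proof (induction zs arbitrary: F)
  case (Cons z zs)
  have "pick2_sum (\<lambda>a b. pick_sum (F a b)) (z # zs)
      = pick2_sum (\<lambda>a b ws. F z a b ws + F z b a ws + F a b z ws) zs
        + pick2_sum (\<lambda>a b. pick_sum (\<lambda>c ws. F a b c (z # ws))) zs"
    by (simp add: pick_sum_pick_sum pick2_sum_add ac_simps)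
  then show ?case
    using Cons by (simp add: pick2_sum_0)
qed simp

text \<open>Two disjoint pairs can be chosen in two orders, so in characteristic 2 the sum cancels.\<close>

lemma pick2_sum_pick2_sum_sym:
  fixes F :: "'a \<Rightarrow> 'a \<Rightarrow> 'a \<Rightarrow> 'a \<Rightarrow> 'a list \<Rightarrow> 'b::comm_monoid_add"
  assumes char2: "\<And>x::'b. x + x = 0"
    and "\<And>a b e f ws. F a b e f ws = F e f a b ws"
  shows "pick2_sum (\<lambda>a b. pick2_sum (F a b)) zs = 0"
  using assms(2)
proof (induction zs arbitrary: F)
  case (Cons z zs)
  have sym: "(\<lambda>b. F z b e f) = F e f z" for e f
    by (intro ext) (rule Cons.prems)
  have "pick2_sum (\<lambda>a b. pick2_sum (F a b)) (z # zs)
     = pick_sum (\<lambda>b. pick2_sum (F z b)) zs + pick2_sum (\<lambda>a b. pick_sum (F a b z)) zs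
       + pick2_sum (\<lambda>a b. pick2_sum (\<lambda>e f ws. F a b e f (z # ws))) zs"
    by (simp add: pick2_sum_add ac_simps)
  also have "pick2_sum (\<lambda>a b. pick2_sum (\<lambda>e f ws. F a b e f (z # ws))) zs = 0"
    by (rule Cons.IH) (rule Cons.prems)
  also have "pick_sum (\<lambda>b. pick2_sum (F z b)) zs = pick2_sum (\<lambda>a b. pick_sum (F a b z)) zs"
    by (simp add: pick_sum_pick2_sum sym)
  finally show ?case
    by (simp add: char2)
qed simp


section \<open>Alternating maps in characteristic 2\<close>

definition perm_invariant :: "('a list \<Rightarrow> 'b) \<Rightarrow> bool" where
  "perm_invariant f \<longleftrightarrow> (\<forall>us a b vs. f (us @ a # b # vs) = f (us @ b # a # vs))"

lemma perm_invariantI: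
  "(\<And>us a b vs. f (us @ a # b # vs) = f (us @ b # a # vs)) \<Longrightarrow> perm_invariant f"
  by (simp add: perm_invariant_def)

lemma perm_invariant_swap:
  "perm_invariant f \<Longrightarrow> f (us @ a # b # vs) = f (us @ b # a # vs)"
  by (simp add: perm_invariant_def)

lemma perm_invariant_Cons: "perm_invariant f \<Longrightarrow> perm_invariant (\<lambda>zs. f (z # zs))"
  by (rule perm_invariantI) (use perm_invariant_swap[of f "z # us" for us] in simp)

lemma perm_invariant_map: "perm_invariant f \<Longrightarrow> perm_invariant (\<lambda>zs. f (map h zs))"
  unfolding perm_invariant_def by simp

lemma perm_invariant_comp: "perm_invariant f \<Longrightarrow> perm_invariant (\<lambda>zs. h (f zs))"
  unfolding perm_invariant_def by simp

lemma perm_invariant_add: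
  "perm_invariant f \<Longrightarrow> perm_invariant g \<Longrightarrow> perm_invariant (\<lambda>zs. f zs + g zs)"
  unfolding perm_invariant_def by simp

lemma perm_invariant_const: "perm_invariant (\<lambda>zs. c)"
  unfolding perm_invariant_def by simp

lemma perm_invariant_move_to_front:
  assumes "perm_invariant f"
  shows "f (us @ a # vs) = f (a # us @ vs)"
proof (induction us arbitrary: vs rule: rev_induct)
  case (snoc u us)
  show ?case
    using snoc.IH[of "u # vs"] perm_invariant_swap[OF assms, of us u a vs] by simp
qed simp

text \<open>Invariance under adjacent swaps is easily inherited by sums over entries; invariance under all
  permutations is what the rearrangements of arguments use.\<close>

lemma perm_invariant_mset:
  assumes "perm_invariant f" "mset xs = mset ys"
  shows "f xs = f ys"
  using assms
proof (induction xs arbitrary: f ys)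
  case (Cons a xs)
  then obtain us vs where ys: "ys = us @ a # vs"
    by (metis list.set_intros(1) set_mset_mset split_list)
  with Cons.prems(2) have "mset xs = mset (us @ vs)"
    by simp
  then show ?case
    using Cons.IH[OF perm_invariant_Cons[OF Cons.prems(1)]]
      perm_invariant_move_to_front[OF Cons.prems(1)] ys by simp
qed simp

lemma perm_invariant_pick_sum:
  assumes "\<And>z. perm_invariant (F z)"
  shows "perm_invariant (pick_sum F)"
proof (rule perm_invariantI)
  show "pick_sum F (us @ a # b # vs) = pick_sum F (us @ b # a # vs)" for us a b vs
    using assms
  proof (induction us arbitrary: F)
    case Nil
    then show ?case
      using perm_invariant_swap[OF Nil, where us = "[]"] by (simp add: add.left_commute)
  next
    case (Cons u us)
    then show ?case
      using perm_invariant_swap[OF Cons.prems, of _ us a b vs] by (simp add: perm_invariant_Cons)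
  qed
qed

lemma perm_invariant_pick2_sum:
  assumes "\<And>a b. perm_invariant (F a b)" "\<And>a b ws. F a b ws = F b a ws"
  shows "perm_invariant (pick2_sum F)"
proof (rule perm_invariantI)
  show "pick2_sum F (us @ a # b # vs) = pick2_sum F (us @ b # a # vs)" for us a b vs
    using assms
  proof (induction us arbitrary: F)
    case Nil
    then show ?case
      using perm_invariant_swap[OF Nil(1), where us = "[]"] by (simp add: ac_simps)
  next
    case (Cons u us)
    have "pick_sum (F u) (us @ a # b # vs) = pick_sum (F u) (us @ b # a # vs)"
      by (rule perm_invariant_swap) (simp add: perm_invariant_pick_sum Cons.prems)
    then show ?case
      using Cons by (simp add: perm_invariant_Cons)
  qed
qed

text \<open>Modulo permutations any slot is the first and any repetition stands at the front, so an
  alternating map is controlled by its behaviour on the first two entries.\<close>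

definition sym_alternating ::
    "('k::field \<Rightarrow> 'v::ab_group_add \<Rightarrow> 'v) \<Rightarrow> ('k \<Rightarrow> 'w::ab_group_add \<Rightarrow> 'w) \<Rightarrow> nat \<Rightarrow>
     ('v list \<Rightarrow> 'w) \<Rightarrow> bool" where
  "sym_alternating sv sw n f \<longleftrightarrow>
     (\<forall>zs. length zs \<noteq> n \<longrightarrow> f zs = 0) \<and>
     perm_invariant f \<and>
     (\<forall>zs. Vector_Spaces.linear sv sw (\<lambda>x. f (x # zs))) \<and>
     (\<forall>a zs. f (a # a # zs) = 0)"

lemma sym_alternating_length: "sym_alternating sv sw n f \<Longrightarrow> length zs \<noteq> n \<Longrightarrow> f zs = 0"
  by (simp add: sym_alternating_def)

lemma sym_alternating_perm_invariant: "sym_alternating sv sw n f \<Longrightarrow> perm_invariant f"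
  by (simp add: sym_alternating_def)

lemma sym_alternating_not_distinct:
  assumes f: "sym_alternating sv sw n f" and rep: "\<not> distinct zs"
  shows "f zs = 0"
proof -
  obtain us vs ws a where zs: "zs = us @ [a] @ vs @ [a] @ ws"
    using not_distinct_decomp[OF rep] by blast
  have "f zs = f (a # a # us @ vs @ ws)"
    by (rule perm_invariant_mset) (use f in \<open>auto simp: sym_alternating_def zs\<close>)
  then show ?thesis
    using f by (simp add: sym_alternating_def)
qed

lemma sym_alternating_linear:
  assumes "sym_alternating sv sw n f"
  shows "f ((x + y) # zs) = f (x # zs) + f (y # zs)"
    and "f (sv a x # zs) = sw a (f (x # zs))"
  using assms by (auto simp: sym_alternating_def Vector_Spaces.linear_iff)

lemma sym_alternating_swap:
  assumes "sym_alternating sv sw n f"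
  shows "f (a # b # zs) = f (b # a # zs)"
  by (rule perm_invariant_mset) (use assms in \<open>auto simp: sym_alternating_def\<close>)

lemma sym_alternating_rotate:
  assumes "sym_alternating sv sw n f"
  shows "f (a # b # e # zs) = f (b # e # a # zs)"
  by (rule perm_invariant_mset) (use assms in \<open>auto simp: sym_alternating_def\<close>)

lemma sym_alternating_linear2:
  assumes "sym_alternating sv sw n f"
  shows "f (b # (x + y) # zs) = f (b # x # zs) + f (b # y # zs)"
    and "f (b # sv a x # zs) = sw a (f (b # x # zs))"
proof -
  have swap: "f (b # y # zs) = f (y # b # zs)" for y
    by (rule sym_alternating_swap[OF assms])
  show "f (b # (x + y) # zs) = f (b # x # zs) + f (b # y # zs)"
    and "f (b # sv a x # zs) = sw a (f (b # x # zs))"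
    unfolding swap by (rule sym_alternating_linear[OF assms])+
qed

lemma sym_alternating_linear3:
  assumes "sym_alternating sv sw n f"
  shows "f (b # e # (x + y) # zs) = f (b # e # x # zs) + f (b # e # y # zs)"
    and "f (b # e # sv a x # zs) = sw a (f (b # e # x # zs))"
proof -
  have rotate: "f (b # e # y # zs) = f (y # b # e # zs)" for y
    by (rule sym_alternating_rotate[OF assms, symmetric])
  show "f (b # e # (x + y) # zs) = f (b # e # x # zs) + f (b # e # y # zs)"
    and "f (b # e # sv a x # zs) = sw a (f (b # e # x # zs))"
    unfolding rotate by (rule sym_alternating_linear[OF assms])+
qed

lemma sym_alternating_Cons_0:
  fixes f :: "'v::ab_group_add list \<Rightarrow> 'w::ab_group_add"
  shows "sym_alternating sv sw n f \<Longrightarrow> f (0 # zs) = 0"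
  using sym_alternating_linear(1)[of sv sw n f 0 0 zs] by simp

lemma alternating_map_iff_sym_alternating:
  fixes sv :: "'k::field \<Rightarrow> 'v::ab_group_add \<Rightarrow> 'v" and sw :: "'k \<Rightarrow> 'w::ab_group_add \<Rightarrow> 'w"
  assumes char2: "\<And>x::'w. x + x = 0"
    and vs: "vector_space sv" "vector_space sw"
  shows "alternating_map sv sw n f \<longleftrightarrow> sym_alternating sv sw n f"
proof
  assume alt: "alternating_map sv sw n f"
  have len: "f zs = 0" if "length zs \<noteq> n" for zs
    using alt that by (simp add: alternating_map_def)
  have lin: "Vector_Spaces.linear sv sw (\<lambda>x. f (us @ x # vs))" if "length us + length vs + 1 = n"
    for us vs
  proof -
    have "length (us @ 0 # vs) = n" "length us < n"
      using that by auto
    then have "Vector_Spaces.linear sv sw (\<lambda>x. f ((us @ 0 # vs)[length us := x]))"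
      using alt unfolding alternating_map_def by blast
    then show ?thesis
      by simp
  qed
  have add: "f (us @ (x + y) # vs) = f (us @ x # vs) + f (us @ y # vs)" for us vs x y
    using lin[of us vs] len[of "us @ _ # vs"]
    by (cases "length us + length vs + 1 = n") (auto simp: Vector_Spaces.linear_iff)
  have rep: "f zs = 0" if "\<not> distinct zs" for zs
    using alt that by (cases "length zs = n") (auto simp: alternating_map_def)
  \<comment> \<open>Polarization at \<open>a + b\<close>; without signs, skew-symmetry is symmetry.\<close>
  have "f (us @ a # b # vs) = f (us @ b # a # vs)" for us a b vs
  proof -
    have "f (us @ (a + b) # (a + b) # vs) = 0"
      by (rule rep) simp
    also have "f (us @ (a + b) # (a + b) # vs) = f (us @ a # a # vs) + f (us @ b # a # vs)
        + (f (us @ a # b # vs) + f (us @ b # b # vs))"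
      using add[of us a b "(a + b) # vs"] add[of "us @ [a]" a b vs] add[of "us @ [b]" a b vs]
      by (simp add: ac_simps)
    finally have "f (us @ b # a # vs) + f (us @ a # b # vs) = 0"
      by (simp add: rep)
    then show ?thesis
      by (metis char2 add_right_imp_eq)
  qed
  moreover have "Vector_Spaces.linear sv sw (\<lambda>x. f (x # zs))" for zs
  proof (cases "length zs + 1 = n")
    case True
    then show ?thesis
      using lin[of "[]" zs] by simp
  next
    case False
    interpret W: vector_space sw
      by (rule vs(2))
    have "f (x # zs) = 0" for x
      using len[of "x # zs"] False by simp
    then show ?thesis
      using vs by (simp add: Vector_Spaces.linear_iff)
  qed
  ultimately show "sym_alternating sv sw n f"
    using len rep unfolding sym_alternating_def perm_invariant_def by simp
next
  assume sym: "sym_alternating sv sw n f"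
  then have perm: "perm_invariant f"
    by (simp add: sym_alternating_def)
  have "f (zs[i := x]) = f (x # take i zs @ drop (Suc i) zs)" if "i < length zs" for zs i x
    using that perm_invariant_move_to_front[OF perm] by (simp add: upd_conv_take_nth_drop)
  moreover have "f zs = 0" if "\<not> distinct zs" for zs
    by (rule sym_alternating_not_distinct[OF sym that])
  ultimately show "alternating_map sv sw n f"
    using sym unfolding alternating_map_def sym_alternating_def by auto
qed


section \<open>Hom-Lie superalgebras and their modules in characteristic 2\<close>

context hom_lie_superalgebra_char2
begin

lemma char2_scale: "(2::'k) = 0"
  using char2 of_nat_CHAR[where ?'a = 'k] by simp

lemma char2_g: "(x::'g) + x = 0"
proof -
  have "x + x = sg 2 x"
    using scale_left_distrib[of 1 1 x] by simp
  then show ?thesis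
    by (simp only: char2_scale scale_zero_left)
qed

lemma br_add_left: "br (x + y) z = br x z + br y z"
  and br_add_right: "br z (x + y) = br z x + br z y"
  and br_scale_left: "br (sg a x) z = sg a (br x z)"
  and br_scale_right: "br z (sg a x) = sg a (br z x)"
  using br_bilinear by (auto simp: bilinear_map_def Vector_Spaces.linear_iff)

lemma \<alpha>_add: "\<alpha> (x + y) = \<alpha> x + \<alpha> y"
  and \<alpha>_scale: "\<alpha> (sg a x) = sg a (\<alpha> x)"
  using \<alpha>_linear by (auto simp: Vector_Spaces.linear_iff)

lemma \<alpha>_mem: "x \<in> G i \<Longrightarrow> \<alpha> x \<in> G i"
  using \<alpha>_even by (simp add: even_map_def)

lemma G_add: "x \<in> G i \<Longrightarrow> y \<in> G i \<Longrightarrow> x + y \<in> G i"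
  by (rule subspace_add[OF subspace_parts])

lemma G_scale: "x \<in> G i \<Longrightarrow> sg a x \<in> G i"
  by (rule subspace_scale[OF subspace_parts])

lemma s_zero: "s 0 = 0"
  using s_scale[OF subspace_0[OF subspace_parts], of 0] by simp

lemma s_add:
  assumes "x \<in> G 1" "y \<in> G 1"
  shows "s (x + y) = br x y + s x + s y"
proof -
  have "s (x + y) + (s x + s y) + (s x + s y) = br x y + s x + s y"
    using s_polar[OF assms] by (simp add: ac_simps)
  then show ?thesis
    by (metis add.assoc add.right_neutral char2_g)
qed

lemma br_self: "br x x = 0"
proof -
  obtain a b where ab: "a \<in> G 0" "b \<in> G 1" "x = a + b"
    using parts_span by blast
  have "br b b = 0"
    using s_polar[OF ab(2) ab(2)] by (simp add: char2_g s_zero)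
  then show ?thesis
    using ab br_even_self[OF ab(1)] br_sym[of a b] by (simp add: br_add_left br_add_right char2_g)
qed

text \<open>Polarizing the axiom on \<open>[s(x), \<alpha>(y)]\<close> yields the Jacobi identity with two odd
  arguments.\<close>

lemma hom_jacobi_odd:
  assumes "x \<in> G 1" "y \<in> G 1"
  shows "br (br x y) (\<alpha> z) = br (\<alpha> x) (br y z) + br (\<alpha> y) (br x z)"
proof -
  have "br (s (x + y)) (\<alpha> z) = br (\<alpha> (x + y)) (br (x + y) z)"
    by (rule s_jacobi[OF G_add[OF assms]])
  then have "br (br x y) (\<alpha> z) + (br (\<alpha> x) (br x z) + br (\<alpha> y) (br y z))
      = (br (\<alpha> x) (br y z) + br (\<alpha> y) (br x z)) + (br (\<alpha> x) (br x z) + br (\<alpha> y) (br y z))"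
    using s_jacobi[OF assms(1), of z] s_jacobi[OF assms(2), of z]
    by (simp add: s_add assms br_add_left br_add_right \<alpha>_add ac_simps)
  then show ?thesis
    by simp
qed

text \<open>The axioms and \<open>hom_jacobi_odd\<close> cover homogeneous arguments of every combination of
  parities; by trilinearity it holds in general.\<close>

lemma hom_jacobi_all: "br (br a b) (\<alpha> c) + br (br a c) (\<alpha> b) + br (br b c) (\<alpha> a) = 0"
proof -
  define J where "J a b c = br (br a b) (\<alpha> c) + br (br a c) (\<alpha> b) + br (br b c) (\<alpha> a)" for a b c
  have add: "J (x + y) b c = J x b c + J y b c" "J a (x + y) c = J a x c + J a y c"
    "J a b (x + y) = J a b x + J a b y" for a b c x y
    by (simp_all add: J_def br_add_left br_add_right \<alpha>_add ac_simps)
  have perm: "J a b c = J b a c" "J a b c = J a c b" for a b c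
    using br_sym by (simp_all add: J_def ac_simps)
  have even: "J a b c = 0" if "a \<in> G 0" "b \<in> G 0" "c \<in> G i" for a b c i
  proof (cases "i = 0")
    case True
    then show ?thesis
      using hom_jacobi[of a b c] that
      by (simp add: J_def br_sym[of "\<alpha> _"] br_sym[of c a] ac_simps)
  next
    case False
    then have "c \<in> G 1"
      using that bit_not_zero_iff by metis
    then show ?thesis
      using odd_module[of a b c] that
      by (simp add: J_def br_sym[of "\<alpha> _"] ac_simps) (simp add: char2_g flip: add.assoc)
  qed
  have odd: "J a b c = 0" if "a \<in> G 1" "b \<in> G 1" for a b c
    using hom_jacobi_odd[OF that, of c]
    by (simp add: J_def br_sym[of "\<alpha> _"] ac_simps) (simp add: char2_g flip: add.assoc)
  obtain a0 a1 where a: "a0 \<in> G 0" "a1 \<in> G 1" "a = a0 + a1"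
    using parts_span by blast
  obtain b0 b1 where b: "b0 \<in> G 0" "b1 \<in> G 1" "b = b0 + b1"
    using parts_span by blast
  obtain c0 c1 where c: "c0 \<in> G 0" "c1 \<in> G 1" "c = c0 + c1"
    using parts_span by blast
  have "J a0 b1 c0 = 0" "J a1 b0 c0 = 0" "J a0 b1 c1 = 0" "J a1 b0 c1 = 0"
    using even[OF a(1) c(1) b(2)] even[OF b(1) c(1) a(2)] odd[OF b(2) c(2), of a0]
      odd[OF a(2) c(2), of b0] perm by metis+
  then have "J a b c = 0"
    using a b c by (simp add: add even[where i = 0] even[where i = 1] odd)
  then show ?thesis
    by (simp add: J_def)
qed

lemma pow_\<alpha>_add: "(\<alpha> ^^ k) (x + y) = (\<alpha> ^^ k) x + (\<alpha> ^^ k) y"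
  by (induction k) (auto simp: \<alpha>_add)

lemma pow_\<alpha>_scale: "(\<alpha> ^^ k) (sg a x) = sg a ((\<alpha> ^^ k) x)"
  by (induction k) (auto simp: \<alpha>_scale)

lemma pow_\<alpha>_br: "(\<alpha> ^^ k) (br x y) = br ((\<alpha> ^^ k) x) ((\<alpha> ^^ k) y)"
  by (induction k) (auto simp: \<alpha>_mult)

lemma pow_\<alpha>_mem: "x \<in> G i \<Longrightarrow> (\<alpha> ^^ k) x \<in> G i"
  by (induction k) (auto simp: \<alpha>_mem)

lemma pow_\<alpha>_s: "x \<in> G 1 \<Longrightarrow> (\<alpha> ^^ k) (s x) = s ((\<alpha> ^^ k) x)"
  by (induction k) (auto simp: \<alpha>_s pow_\<alpha>_mem)

end

context hom_lie_module_char2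
begin

lemma char2_m: "(m::'m) + m = 0"
proof -
  have "m + m = sm 2 m"
    using M.scale_left_distrib[of 1 1 m] by simp
  then show ?thesis
    by (simp only: char2_scale M.scale_zero_left)
qed

lemma char2_m_left: "(m::'m) + (m + n) = n"
  by (simp add: char2_m flip: add.assoc)

lemma add_eq_0_m: "(m::'m) + n = 0 \<longleftrightarrow> m = n"
  by (metis add_right_cancel char2_m)

lemma act_add_left: "(x + y) \<bullet> m = x \<bullet> m + y \<bullet> m"
  and act_add_right: "x \<bullet> (m + n) = x \<bullet> m + x \<bullet> n"
  and act_scale_left: "(sg a x) \<bullet> m = sm a (x \<bullet> m)"
  and act_scale_right: "x \<bullet> (sm a m) = sm a (x \<bullet> m)"
  using act_bilinear by (auto simp: bilinear_map_def Vector_Spaces.linear_iff)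

lemma act_zero_right: "x \<bullet> 0 = 0"
  using act_add_right[of x 0 0] by simp

lemma \<beta>_add: "\<beta> (m + n) = \<beta> m + \<beta> n"
  and \<beta>_scale: "\<beta> (sm a m) = sm a (\<beta> m)"
  using \<beta>_linear by (auto simp: Vector_Spaces.linear_iff)

lemma \<beta>_zero: "\<beta> 0 = 0"
  using \<beta>_add[of 0 0] by simp

lemma act_br_pow:
  "(\<alpha> ^^ k) (br x y) \<bullet> \<beta> m
    = (\<alpha> ^^ Suc k) x \<bullet> (\<alpha> ^^ k) y \<bullet> m + (\<alpha> ^^ Suc k) y \<bullet> (\<alpha> ^^ k) x \<bullet> m"
  by (simp add: pow_\<alpha>_br act_br)

lemma act_s_pow:
  "x \<in> G 1 \<Longrightarrow> (\<alpha> ^^ k) (s x) \<bullet> \<beta> m = (\<alpha> ^^ Suc k) x \<bullet> (\<alpha> ^^ k) x \<bullet> m"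
  by (simp add: pow_\<alpha>_s act_s pow_\<alpha>_mem)

lemmas act_pick_sum = pick_sum_hom[where h = "act x" for x, OF act_add_right act_zero_right]
lemmas act_pick2_sum = pick2_sum_hom[where h = "act x" for x, OF act_add_right act_zero_right]
lemmas \<beta>_pick_sum = pick_sum_hom[where h = \<beta>, OF \<beta>_add \<beta>_zero]
lemmas \<beta>_pick2_sum = pick2_sum_hom[where h = \<beta>, OF \<beta>_add \<beta>_zero]

section \<open>The square of the differential\<close>

text \<open>The two components of the differential with the exponent of \<open>\<alpha>\<close> decoupled from the length of
  the list, so that the identities below hold on lists of any length.\<close>

definition diff_c :: "nat \<Rightarrow> ('g list \<Rightarrow> 'm) \<Rightarrow> 'g list \<Rightarrow> 'm" where
  "diff_c k c zs = pick_sum (\<lambda>z ws. (\<alpha> ^^ k) z \<bullet> c ws) zs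
     + pick2_sum (\<lambda>a b ws. c (br a b # map \<alpha> ws)) zs"

definition diff_p ::
    "nat \<Rightarrow> ('g list \<Rightarrow> 'm) \<Rightarrow> ('g \<Rightarrow> 'g list \<Rightarrow> 'm) \<Rightarrow> 'g \<Rightarrow> 'g list \<Rightarrow> 'm" where
  "diff_p k c p x zs = (\<alpha> ^^ k) x \<bullet> c (x # zs) + c (s x # map \<alpha> zs)
     + pick_sum (\<lambda>z ws. (\<alpha> ^^ k) z \<bullet> p x ws) zs
     + pick_sum (\<lambda>z ws. c (br x z # \<alpha> x # map \<alpha> ws)) zs
     + pick2_sum (\<lambda>a b ws. p (\<alpha> x) (br a b # map \<alpha> ws)) zs"

text \<open>Applying \<open>diff_c\<close> under the action and under the bracket produces the same two sums \<open>t1\<close> and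
  \<open>t2\<close>. The bracket produces two more: nested brackets, which vanish by the Jacobi identity, and
  disjoint brackets, which come in equal pairs.\<close>

lemma diff_c_squared:
  assumes swap: "\<And>a b zs. c (a # b # zs) = c (b # a # zs)"
    and add: "\<And>a b zs. c ((a + b) # zs) = c (a # zs) + c (b # zs)"
    and equiv: "\<And>zs. c (map \<alpha> zs) = \<beta> (c zs)"
  shows "diff_c (Suc k) (diff_c k c) zs = 0"
proof -
  have c0: "c (0 # zs) = 0" for zs
    using add[of 0 0 zs] by simp
  have jac: "c (br (br a b) (\<alpha> e) # ws) + c (br (br a e) (\<alpha> b) # ws)
      + c (br (br b e) (\<alpha> a) # ws) = 0" for a b e ws
    by (simp add: hom_jacobi_all c0 flip: add)
  define t1 where "t1 = pick2_sum (\<lambda>a b ws. (\<alpha> ^^ k) (br a b) \<bullet> c (map \<alpha> ws)) zs"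
  define t2 where "t2 = pick2_sum (\<lambda>a b. pick_sum (\<lambda>z ws.
      (\<alpha> ^^ Suc k) z \<bullet> c (br a b # map \<alpha> ws))) zs"
  have outer: "pick_sum (\<lambda>z ws. (\<alpha> ^^ Suc k) z \<bullet> diff_c k c ws) zs = t1 + t2"
    using pick_sum_pick_sum[of "\<lambda>z w us. (\<alpha> ^^ Suc k) z \<bullet> (\<alpha> ^^ k) w \<bullet> c us" zs]
      pick_sum_pick2_sum[of "\<lambda>z a b us. (\<alpha> ^^ Suc k) z \<bullet> c (br a b # map \<alpha> us)" zs]
    unfolding t1_def t2_def equiv act_br_pow
    by (simp add: diff_c_def act_add_right act_pick_sum act_pick2_sum pick_sum_add)
  have "pick2_sum (\<lambda>a b ws. diff_c k c (br a b # map \<alpha> ws)) zs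
    = t1 + t2
      + pick2_sum (\<lambda>a b. pick_sum (\<lambda>z ws. c (br (br a b) (\<alpha> z) # map \<alpha> (map \<alpha> ws)))) zs
      + pick2_sum (\<lambda>a b. pick2_sum (\<lambda>e f ws.
          c (br (\<alpha> e) (\<alpha> f) # br (\<alpha> a) (\<alpha> b) # map \<alpha> (map \<alpha> ws)))) zs"
    by (simp add: diff_c_def t1_def t2_def pick_sum_map pick2_sum_map pick2_sum_add \<alpha>_mult
        funpow_swap1 ac_simps del: map_map)
  also have "pick2_sum (\<lambda>a b. pick_sum (\<lambda>z ws.
      c (br (br a b) (\<alpha> z) # map \<alpha> (map \<alpha> ws)))) zs = 0"
    by (rule pick2_sum_pick_sum_jacobi) (rule jac)
  also have "pick2_sum (\<lambda>a b. pick2_sum (\<lambda>e f ws.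
      c (br (\<alpha> e) (\<alpha> f) # br (\<alpha> a) (\<alpha> b) # map \<alpha> (map \<alpha> ws)))) zs = 0"
    by (rule pick2_sum_pick2_sum_sym[OF char2_m]) (rule swap)
  finally show ?thesis
    unfolding diff_c_def[of "Suc k"] outer by (simp add: char2_m)
qed

text \<open>Each of the five parts of the outer differential is expanded separately. Of the resulting sums,
  each of those named \<open>u\<close>, \<open>v\<close>, \<open>w\<close>, \<open>y\<close> below occurs in exactly two of the five expansions, and the others
  vanish on their own.\<close>

lemma diff_p_squared:
  assumes x: "x \<in> G 1"
    and c_perm: "perm_invariant c"
    and c_add: "\<And>a b zs. c ((a + b) # zs) = c (a # zs) + c (b # zs)"
    and c_equiv: "\<And>zs. c (map \<alpha> zs) = \<beta> (c zs)"
    and p_swap: "\<And>y a b zs. y \<in> G 1 \<Longrightarrow> p y (a # b # zs) = p y (b # a # zs)"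
    and p_add: "\<And>y a b zs. y \<in> G 1 \<Longrightarrow> p y ((a + b) # zs) = p y (a # zs) + p y (b # zs)"
    and p_equiv: "\<And>y zs. y \<in> G 1 \<Longrightarrow> p (\<alpha> y) (map \<alpha> zs) = \<beta> (p y zs)"
  shows "diff_p (Suc k) (diff_c k c) (diff_p k c p) x zs = 0"
proof -
  have \<alpha>x: "\<alpha> x \<in> G 1" and \<alpha>\<alpha>x: "\<alpha> (\<alpha> x) \<in> G 1"
    using x by (auto intro: \<alpha>_mem)
  have c_equiv_Cons: "c (\<alpha> y # map \<alpha> zs) = \<beta> (c (y # zs))" for y zs
    using c_equiv[of "y # zs"] by simp
  have c_swap: "c (a # b # zs) = c (b # a # zs)" for a b zs
    by (rule perm_invariant_mset[OF c_perm]) simp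
  have c_rotate: "c (a # b # e # zs) = c (b # e # a # zs)" for a b e zs
    by (rule perm_invariant_mset[OF c_perm]) simp
  have c0: "c (0 # zs) = 0" for zs
    using c_add[of 0 0 zs] by simp
  have p0: "p (\<alpha> (\<alpha> x)) (0 # zs) = 0" for zs
    using p_add[OF \<alpha>\<alpha>x, of 0 0 zs] by simp
  have c_jac: "c (br (\<alpha> x) (br a b) # ws) + (c (br (br x a) (\<alpha> b) # ws)
      + c (br (br x b) (\<alpha> a) # ws)) = 0" for a b ws
    using hom_jacobi_all[of x a b]
    by (simp add: c0 br_sym[of "\<alpha> x"] ac_simps flip: c_add)
  have p_jac: "p (\<alpha> (\<alpha> x)) (br (br a b) (\<alpha> e) # ws) + p (\<alpha> (\<alpha> x)) (br (br a e) (\<alpha> b) # ws)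
      + p (\<alpha> (\<alpha> x)) (br (br b e) (\<alpha> a) # ws) = 0" for a b e ws
    by (simp add: hom_jacobi_all p0 flip: p_add[OF \<alpha>\<alpha>x])
  define \<alpha>2 where "\<alpha>2 ws = map \<alpha> (map \<alpha> ws)" for ws
  define u1 where "u1 = (\<alpha> ^^ Suc k) x \<bullet> (\<alpha> ^^ k) x \<bullet> c zs"
  define u2 where "u2 = pick_sum (\<lambda>z ws. (\<alpha> ^^ Suc k) x \<bullet> (\<alpha> ^^ k) z \<bullet> c (x # ws)) zs"
  define u3 where "u3 = pick_sum (\<lambda>z ws. (\<alpha> ^^ Suc k) x \<bullet> c (br x z # map \<alpha> ws)) zs"
  define u4 where
    "u4 = pick2_sum (\<lambda>a b ws. (\<alpha> ^^ Suc k) x \<bullet> c (br a b # \<alpha> x # map \<alpha> ws)) zs"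
  define v1 where "v1 = pick_sum (\<lambda>z ws. (\<alpha> ^^ Suc k) z \<bullet> c (s x # map \<alpha> ws)) zs"
  define v2 where "v2 = pick_sum (\<lambda>z ws. c (br (\<alpha> x) (br x z) # \<alpha>2 ws)) zs"
  define v3 where
    "v3 = pick2_sum (\<lambda>a b ws. c (br (\<alpha> a) (\<alpha> b) # s (\<alpha> x) # \<alpha>2 ws)) zs"
  define w1 where "w1 = pick_sum (\<lambda>z ws. (\<alpha> ^^ Suc k) z \<bullet> (\<alpha> ^^ k) x \<bullet> c (x # ws)) zs"
  define w2 where
    "w2 = pick2_sum (\<lambda>a b ws. (\<alpha> ^^ k) (br a b) \<bullet> p (\<alpha> x) (map \<alpha> ws)) zs"
  define w3 where "w3 = pick_sum (\<lambda>z. pick_sum (\<lambda>w ws.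
      (\<alpha> ^^ Suc k) z \<bullet> c (br x w # \<alpha> x # map \<alpha> ws))) zs"
  define w4 where "w4 = pick_sum (\<lambda>z. pick2_sum (\<lambda>a b ws.
      (\<alpha> ^^ Suc k) z \<bullet> p (\<alpha> x) (br a b # map \<alpha> ws))) zs"
  define y1 where "y1 = pick_sum (\<lambda>z. pick_sum (\<lambda>w ws.
      c (br (br x z) (\<alpha> w) # \<alpha> (\<alpha> x) # \<alpha>2 ws))) zs"
  define y2 where "y2 = pick_sum (\<lambda>z. pick2_sum (\<lambda>a b ws.
      c (br (\<alpha> a) (\<alpha> b) # br (\<alpha> x) (\<alpha> z) # \<alpha> (\<alpha> x) # \<alpha>2 ws))) zs"

  have T1: "(\<alpha> ^^ Suc k) x \<bullet> diff_c k c (x # zs) = u1 + u2 + u3 + u4"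
    by (simp add: diff_c_def u1_def u2_def u3_def u4_def act_add_right act_pick_sum
        act_pick2_sum ac_simps)
  have s1: "(\<alpha> ^^ k) (s x) \<bullet> c (map \<alpha> zs) = u1"
    by (simp only: c_equiv act_s_pow[OF x] u1_def)
  have T2: "diff_c k c (s x # map \<alpha> zs) = u1 + v1 + v2 + v3"
    unfolding s1[symmetric]
    by (simp add: diff_c_def v1_def v2_def v3_def pick_sum_map pick2_sum_map \<alpha>2_def
        funpow_swap1 s_jacobi[OF x] \<alpha>_s[OF x] ac_simps del: map_map)
  have w2_eq: "w2 = pick_sum (\<lambda>z. pick_sum (\<lambda>w ws. (\<alpha> ^^ Suc k) z \<bullet> (\<alpha> ^^ k) w \<bullet> p x ws)) zs"
    by (simp only: w2_def p_equiv[OF x] act_br_pow pick_sum_pick_sum)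
  have T3: "pick_sum (\<lambda>z ws. (\<alpha> ^^ Suc k) z \<bullet> diff_p k c p x ws) zs
      = w1 + v1 + w2 + w3 + w4"
    unfolding w2_eq
    by (simp add: diff_p_def w1_def v1_def w3_def w4_def act_add_right act_pick_sum
        act_pick2_sum pick_sum_add ac_simps)
  \<comment> \<open>The action of \<open>[x, z]\<close> splits into the two orders of acting with \<open>x\<close> and \<open>z\<close>; one order
    comes from the outer \<open>x\<close>, the other from the outer \<open>z\<close>.\<close>
  have s4a: "pick_sum (\<lambda>z ws. (\<alpha> ^^ k) (br x z) \<bullet> c (\<alpha> x # map \<alpha> ws)) zs = u2 + w1"
    by (simp only: c_equiv_Cons act_br_pow pick_sum_add u2_def w1_def)
  have s4c: "pick_sum (\<lambda>z. pick_sum (\<lambda>w ws.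
      (\<alpha> ^^ Suc k) w \<bullet> c (br x z # \<alpha> x # map \<alpha> ws))) zs = w3"
    unfolding w3_def by (rule pick_sum_pick_sum_swap)
  \<comment> \<open>Exchanging the two entries \<open>z\<close> and \<open>w\<close> exchanges the first two arguments of \<open>c\<close>, so the
    two orders cancel.\<close>
  have s4f: "pick_sum (\<lambda>z. pick_sum (\<lambda>w ws.
      c (br (\<alpha> x) (\<alpha> w) # br (\<alpha> x) (\<alpha> z) # \<alpha>2 ws))) zs = 0"
    unfolding pick_sum_pick_sum
    by (subst c_swap) (simp add: char2_m pick2_sum_0)
  have "pick_sum (\<lambda>z ws. diff_c k c (br x z # \<alpha> x # map \<alpha> ws)) zs
      = pick_sum (\<lambda>z ws. (\<alpha> ^^ k) (br x z) \<bullet> c (\<alpha> x # map \<alpha> ws)) zs + u3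
        + pick_sum (\<lambda>z. pick_sum (\<lambda>w ws.
            (\<alpha> ^^ Suc k) w \<bullet> c (br x z # \<alpha> x # map \<alpha> ws))) zs
        + v2 + y1
        + pick_sum (\<lambda>z. pick_sum (\<lambda>w ws.
            c (br (\<alpha> x) (\<alpha> w) # br (\<alpha> x) (\<alpha> z) # \<alpha>2 ws))) zs
        + y2"
    by (simp add: diff_c_def u3_def v2_def y1_def y2_def pick_sum_add pick_sum_map pick2_sum_map
        \<alpha>2_def funpow_swap1 \<alpha>_mult br_sym[of "br x _" "\<alpha> x"] ac_simps del: map_map)
  then have T4: "pick_sum (\<lambda>z ws. diff_c k c (br x z # \<alpha> x # map \<alpha> ws)) zs
      = u2 + w1 + u3 + w3 + v2 + y1 + y2"
    by (simp only: s4a s4c s4f add_0_right)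
  have s5a: "pick2_sum (\<lambda>a b ws. (\<alpha> ^^ Suc k) x \<bullet> c (\<alpha> x # br a b # map \<alpha> ws)) zs = u4"
    unfolding u4_def by (subst c_swap) (rule refl)
  have s5b: "pick2_sum (\<lambda>a b ws. c (s (\<alpha> x) # br (\<alpha> a) (\<alpha> b) # \<alpha>2 ws)) zs = v3"
    unfolding v3_def by (subst c_swap) (rule refl)
  have s5d: "pick2_sum (\<lambda>a b. pick_sum (\<lambda>z ws.
      (\<alpha> ^^ Suc k) z \<bullet> p (\<alpha> x) (br a b # map \<alpha> ws))) zs = w4"
    unfolding w4_def by (rule pick_sum_pick2_sum[symmetric])
  \<comment> \<open>The Jacobi identity for \<open>x\<close>, \<open>a\<close>, \<open>b\<close> says that bracketing \<open>x\<close> with \<open>[a, b]\<close> equals the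
    sum over both orders of bracketing \<open>x\<close> with \<open>a\<close> and \<open>b\<close> in turn.\<close>
  have s5e: "pick2_sum (\<lambda>a b ws. c (br (\<alpha> x) (br a b) # \<alpha> (\<alpha> x) # \<alpha>2 ws)) zs = y1"
    unfolding y1_def pick_sum_pick_sum using c_jac by (simp add: add_eq_0_m)
  have s5f: "pick2_sum (\<lambda>a b. pick_sum (\<lambda>z ws.
      c (br (\<alpha> x) (\<alpha> z) # \<alpha> (\<alpha> x) # br (\<alpha> a) (\<alpha> b) # \<alpha>2 ws))) zs = y2"
    unfolding y2_def pick_sum_pick2_sum
    by (intro pick2_sum_cong pick_sum_cong) (rule c_rotate[symmetric])
  have s5g: "pick2_sum (\<lambda>a b. pick_sum (\<lambda>z ws.
      p (\<alpha> (\<alpha> x)) (br (br a b) (\<alpha> z) # \<alpha>2 ws))) zs = 0"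
    by (rule pick2_sum_pick_sum_jacobi) (rule p_jac)
  have s5h: "pick2_sum (\<lambda>a b. pick2_sum (\<lambda>e f ws.
      p (\<alpha> (\<alpha> x)) (br (\<alpha> e) (\<alpha> f) # br (\<alpha> a) (\<alpha> b) # \<alpha>2 ws))) zs = 0"
    by (rule pick2_sum_pick2_sum_sym[OF char2_m]) (rule p_swap[OF \<alpha>\<alpha>x])
  have "pick2_sum (\<lambda>a b ws. diff_p k c p (\<alpha> x) (br a b # map \<alpha> ws)) zs
      = pick2_sum (\<lambda>a b ws. (\<alpha> ^^ Suc k) x \<bullet> c (\<alpha> x # br a b # map \<alpha> ws)) zs
        + pick2_sum (\<lambda>a b ws. c (s (\<alpha> x) # br (\<alpha> a) (\<alpha> b) # \<alpha>2 ws)) zs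
        + w2
        + pick2_sum (\<lambda>a b. pick_sum (\<lambda>z ws.
            (\<alpha> ^^ Suc k) z \<bullet> p (\<alpha> x) (br a b # map \<alpha> ws))) zs
        + pick2_sum (\<lambda>a b ws. c (br (\<alpha> x) (br a b) # \<alpha> (\<alpha> x) # \<alpha>2 ws)) zs
        + pick2_sum (\<lambda>a b. pick_sum (\<lambda>z ws.
            c (br (\<alpha> x) (\<alpha> z) # \<alpha> (\<alpha> x) # br (\<alpha> a) (\<alpha> b) # \<alpha>2 ws))) zs
        + pick2_sum (\<lambda>a b. pick_sum (\<lambda>z ws.
            p (\<alpha> (\<alpha> x)) (br (br a b) (\<alpha> z) # \<alpha>2 ws))) zs
        + pick2_sum (\<lambda>a b. pick2_sum (\<lambda>e f ws.
            p (\<alpha> (\<alpha> x)) (br (\<alpha> e) (\<alpha> f) # br (\<alpha> a) (\<alpha> b) # \<alpha>2 ws))) zs"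
    by (simp add: diff_p_def w2_def pick2_sum_add pick_sum_map pick2_sum_map
        \<alpha>2_def funpow_swap1 \<alpha>_mult ac_simps del: map_map)
  then have T5: "pick2_sum (\<lambda>a b ws. diff_p k c p (\<alpha> x) (br a b # map \<alpha> ws)) zs
      = u4 + v3 + w2 + w4 + y1 + y2"
    by (simp only: s5a s5b s5d s5e s5f s5g s5h add_0_right)
  show ?thesis
    unfolding diff_p_def[of "Suc k"] T1 T2 T3 T4 T5
    by (simp add: ac_simps char2_m char2_m_left)
qed

end


section \<open>The differential maps cochains to cochains\<close>

lemma lambda_zero: "(\<lambda>_. 0) = 0"
  by (simp add: fun_eq_iff)

context hom_lie_module_char2
begin

lemmas scale_pick_sum =
  pick_sum_hom[where h = "sm a" for a, OF M.scale_right_distrib M.scale_zero_right]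
lemmas scale_pick2_sum =
  pick2_sum_hom[where h = "sm a" for a, OF M.scale_right_distrib M.scale_zero_right]

lemma alternating_map_iff:
  "alternating_map sg sm n f \<longleftrightarrow> sym_alternating sg sm n f"
  by (rule alternating_map_iff_sym_alternating[OF char2_m vector_space_axioms
        M.vector_space_axioms])

lemma sym_alternatingI:
  assumes "\<And>zs. length zs \<noteq> n \<Longrightarrow> f zs = 0"
    and "perm_invariant f"
    and "\<And>x y zs. f ((x + y) # zs) = f (x # zs) + f (y # zs)"
    and "\<And>a x zs. f (sg a x # zs) = sm a (f (x # zs))"
    and "\<And>a zs. f (a # a # zs) = 0"
  shows "sym_alternating sg sm n f"
  using assms vector_space_axioms M.vector_space_axioms
  by (simp add: sym_alternating_def Vector_Spaces.linear_iff)

lemma diff_c_Cons: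
  "diff_c k c (x # zs) = (\<alpha> ^^ k) x \<bullet> c zs + pick_sum (\<lambda>w ws. (\<alpha> ^^ k) w \<bullet> c (x # ws)) zs
     + pick_sum (\<lambda>w ws. c (br x w # map \<alpha> ws)) zs
     + pick2_sum (\<lambda>a b ws. c (br a b # \<alpha> x # map \<alpha> ws)) zs"
  by (simp add: diff_c_def ac_simps)

lemma diff_p_Cons:
  "diff_p k c p x (y # zs) = (\<alpha> ^^ k) x \<bullet> c (x # y # zs) + c (s x # \<alpha> y # map \<alpha> zs)
     + (\<alpha> ^^ k) y \<bullet> p x zs + pick_sum (\<lambda>w ws. (\<alpha> ^^ k) w \<bullet> p x (y # ws)) zs
     + c (br x y # \<alpha> x # map \<alpha> zs)
     + pick_sum (\<lambda>w ws. c (br x w # \<alpha> x # \<alpha> y # map \<alpha> ws)) zs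
     + pick_sum (\<lambda>w ws. p (\<alpha> x) (br y w # map \<alpha> ws)) zs
     + pick2_sum (\<lambda>a b ws. p (\<alpha> x) (br a b # \<alpha> y # map \<alpha> ws)) zs"
  by (simp add: diff_p_def ac_simps)

lemma diff_c_length:
  assumes "sym_alternating sg sm n c" "length zs \<noteq> Suc n"
  shows "diff_c k c zs = 0"
proof -
  have "pick_sum (\<lambda>z ws. (\<alpha> ^^ k) z \<bullet> c ws) zs = 0"
    by (rule pick_sum_eq_0) (use assms in \<open>simp add: sym_alternating_length act_zero_right\<close>)
  moreover have "pick2_sum (\<lambda>a b ws. c (br a b # map \<alpha> ws)) zs = 0"
    by (rule pick2_sum_eq_0) (use assms in \<open>simp add: sym_alternating_length\<close>)
  ultimately show ?thesis
    by (simp add: diff_c_def)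
qed

lemma sym_alternating_diff_c:
  assumes c: "sym_alternating sg sm n c"
  shows "sym_alternating sg sm (Suc n) (diff_c k c)"
proof (rule sym_alternatingI)
  note perm = sym_alternating_perm_invariant[OF c]
  note lin = sym_alternating_linear[OF c] sym_alternating_linear2[OF c]
  show "diff_c k c zs = 0" if "length zs \<noteq> Suc n" for zs
    by (rule diff_c_length[OF c that])
  show "perm_invariant (diff_c k c)"
    unfolding diff_c_def
    by (intro perm_invariant_add perm_invariant_pick_sum perm_invariant_pick2_sum
        perm_invariant_comp[OF perm] perm_invariant_map[OF perm_invariant_Cons[OF perm]])
      (simp add: br_sym)
  show "diff_c k c ((x + y) # zs) = diff_c k c (x # zs) + diff_c k c (y # zs)" for x y zs
    by (simp add: diff_c_Cons lin pow_\<alpha>_add \<alpha>_add br_add_left act_add_left act_add_right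
        pick_sum_add pick2_sum_add ac_simps)
  show "diff_c k c (sg a x # zs) = sm a (diff_c k c (x # zs))" for a x zs
    by (simp add: diff_c_Cons lin pow_\<alpha>_scale \<alpha>_scale br_scale_left act_scale_left
        act_scale_right M.scale_right_distrib scale_pick_sum scale_pick2_sum)
  have rep: "c (a # a # zs) = 0" "c (b # a # a # zs) = 0" for a b zs
    by (simp_all add: sym_alternating_not_distinct[OF c])
  show "diff_c k c (a # a # zs) = 0" for a zs
    by (simp add: diff_c_Cons rep act_zero_right pick_sum_0 pick2_sum_0 br_self char2_m
        sym_alternating_Cons_0[OF c] ac_simps char2_m_left)
qed

text \<open>Degree 1, where there is no component \<open>p\<close>, obeys the formulas of the higher degrees once \<open>p\<close>
  is set to \<open>0\<close>; this lets all degrees from 1 on be treated at once.\<close>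

definition is_cochain :: "nat \<Rightarrow> ('g, 'm) cochain \<Rightarrow> bool" where
  "is_cochain n f \<longleftrightarrow>
     sym_alternating sg sm n (fst f) \<and>
     (\<forall>x. x \<notin> G 1 \<longrightarrow> snd f x = 0) \<and>
     (\<forall>x \<in> G 1. sym_alternating sg sm (n - 2) (snd f x)) \<and>
     (n < 2 \<longrightarrow> snd f = 0) \<and>
     (\<forall>x \<in> G 1. \<forall>a zs. snd f (sg a x) zs = sm (a\<^sup>2) (snd f x zs)) \<and>
     (\<forall>zs. \<beta> (fst f zs) = fst f (map \<alpha> zs)) \<and>
     (\<forall>x \<in> G 1. \<forall>zs. \<beta> (snd f x zs) = snd f (\<alpha> x) (map \<alpha> zs)) \<and>
     (\<forall>x \<in> G 1. \<forall>y \<in> G 1. \<forall>zs.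
        snd f (x + y) zs + snd f x zs + snd f y zs = fst f (x # y # zs))"

definition diff :: "nat \<Rightarrow> ('g, 'm) cochain \<Rightarrow> ('g, 'm) cochain" where
  "diff n f = (diff_c (n - 1) (fst f),
     \<lambda>x. if x \<in> G 1 then diff_p (n - 1) (fst f) (snd f) x else 0)"

context
  fixes n c p
  assumes cochain: "is_cochain n (c, p)"
begin

lemma c_alternating: "sym_alternating sg sm n c"
  and p_alternating: "x \<in> G 1 \<Longrightarrow> sym_alternating sg sm (n - 2) (p x)"
  and p_scale: "x \<in> G 1 \<Longrightarrow> p (sg a x) zs = sm (a\<^sup>2) (p x zs)"
  and c_equiv: "c (map \<alpha> zs) = \<beta> (c zs)"
  and p_equiv: "x \<in> G 1 \<Longrightarrow> p (\<alpha> x) (map \<alpha> zs) = \<beta> (p x zs)"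
  using cochain by (auto simp: is_cochain_def)

lemma c_equiv_Cons: "c (\<alpha> x # map \<alpha> zs) = \<beta> (c (x # zs))"
  using c_equiv[of "x # zs"] by simp

lemma p_length: "x \<in> G 1 \<Longrightarrow> length zs + 2 \<noteq> n \<Longrightarrow> p x zs = 0"
  using sym_alternating_length[OF p_alternating, of x zs] cochain
  by (cases "n < 2") (auto simp: is_cochain_def)

lemma p_add:
  assumes "x \<in> G 1" "y \<in> G 1"
  shows "p (x + y) zs = c (x # y # zs) + (p x zs + p y zs)"
proof -
  have "p (x + y) zs + (p x zs + p y zs) = c (x # y # zs)"
    using cochain assms by (simp add: is_cochain_def ac_simps)
  then show ?thesis
    by (metis add.assoc add.right_neutral char2_m)
qed

lemma diff_p_length:
  assumes x: "x \<in> G 1" and len: "Suc (length zs) \<noteq> n"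
  shows "diff_p k c p x zs = 0"
proof -
  note c0 = sym_alternating_length[OF c_alternating]
  have "pick_sum (\<lambda>z ws. (\<alpha> ^^ k) z \<bullet> p x ws) zs = 0"
    by (rule pick_sum_eq_0) (use len in \<open>simp add: p_length[OF x] act_zero_right\<close>)
  moreover have "pick_sum (\<lambda>z ws. c (br x z # \<alpha> x # map \<alpha> ws)) zs = 0"
    by (rule pick_sum_eq_0) (use len in \<open>simp add: c0\<close>)
  moreover have "pick2_sum (\<lambda>a b ws. p (\<alpha> x) (br a b # map \<alpha> ws)) zs = 0"
    by (rule pick2_sum_eq_0) (use len in \<open>simp add: p_length[OF \<alpha>_mem[OF x]]\<close>)
  ultimately show ?thesis
    using len by (simp add: diff_p_def c0 act_zero_right)
qed

lemma sym_alternating_diff_p: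
  assumes x: "x \<in> G 1"
  shows "sym_alternating sg sm (n - 1) (diff_p k c p x)"
proof (rule sym_alternatingI)
  note \<alpha>x = \<alpha>_mem[OF x]
  note c_perm = sym_alternating_perm_invariant[OF c_alternating]
  note p_perm = sym_alternating_perm_invariant[OF p_alternating]
  note lin = sym_alternating_linear[OF c_alternating] sym_alternating_linear2[OF c_alternating]
    sym_alternating_linear3[OF c_alternating] sym_alternating_linear[OF p_alternating[OF x]]
    sym_alternating_linear[OF p_alternating[OF \<alpha>x]]
    sym_alternating_linear2[OF p_alternating[OF \<alpha>x]]
  show "diff_p k c p x zs = 0" if "length zs \<noteq> n - 1" for zs
    using that by (intro diff_p_length[OF x]) auto
  show "perm_invariant (diff_p k c p x)"
    unfolding diff_p_def
    by (intro perm_invariant_add perm_invariant_pick_sum perm_invariant_pick2_sum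
        perm_invariant_comp[OF p_perm[OF x]] perm_invariant_comp[OF perm_invariant_Cons[OF c_perm]]
        perm_invariant_map[OF perm_invariant_Cons[OF perm_invariant_Cons[OF c_perm]]]
        perm_invariant_map[OF perm_invariant_Cons[OF c_perm]]
        perm_invariant_map[OF perm_invariant_Cons[OF p_perm[OF \<alpha>x]]])
      (simp add: br_sym)
  show "diff_p k c p x ((y + z) # zs) = diff_p k c p x (y # zs) + diff_p k c p x (z # zs)"
    for y z zs
    by (simp add: diff_p_Cons lin pow_\<alpha>_add \<alpha>_add br_add_left br_add_right act_add_left
        act_add_right pick_sum_add pick2_sum_add ac_simps)
  show "diff_p k c p x (sg a y # zs) = sm a (diff_p k c p x (y # zs))" for a y zs
    by (simp add: diff_p_Cons lin pow_\<alpha>_scale \<alpha>_scale br_scale_left br_scale_right act_scale_left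
        act_scale_right M.scale_right_distrib scale_pick_sum scale_pick2_sum)
  have rep: "c (b # a # a # zs) = 0" "c (b # e # a # a # zs) = 0" "p x (a # a # zs) = 0"
    "p (\<alpha> x) (b # a # a # zs) = 0" for a b e zs
    by (simp_all add: sym_alternating_not_distinct[OF c_alternating]
        sym_alternating_not_distinct[OF p_alternating[OF x]]
        sym_alternating_not_distinct[OF p_alternating[OF \<alpha>x]])
  show "diff_p k c p x (a # a # zs) = 0" for a zs
    by (simp add: diff_p_Cons rep act_zero_right pick_sum_0 pick2_sum_0 br_self char2_m
        sym_alternating_Cons_0[OF p_alternating[OF \<alpha>x]] ac_simps char2_m_left)
qed

lemma diff_p_scale:
  assumes x: "x \<in> G 1"
  shows "diff_p k c p (sg a x) zs = sm (a\<^sup>2) (diff_p k c p x zs)"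
proof -
  note lin = sym_alternating_linear[OF c_alternating] sym_alternating_linear2[OF c_alternating]
  show ?thesis
    by (simp add: diff_p_def lin pow_\<alpha>_scale \<alpha>_scale br_scale_left act_scale_left
        act_scale_right s_scale[OF x] p_scale[OF x] p_scale[OF \<alpha>_mem[OF x]] M.scale_right_distrib
        scale_pick_sum scale_pick2_sum power2_eq_square)
qed

lemma diff_c_equiv: "\<beta> (diff_c k c zs) = diff_c k c (map \<alpha> zs)"
  using c_equiv_Cons[of "br _ _"]
  by (simp add: diff_c_def \<beta>_add \<beta>_pick_sum \<beta>_pick2_sum pick_sum_map pick2_sum_map c_equiv
      act_mult[symmetric] funpow_swap1 \<alpha>_mult[symmetric] del: map_map)

lemma diff_p_equiv:
  assumes x: "x \<in> G 1"
  shows "\<beta> (diff_p k c p x zs) = diff_p k c p (\<alpha> x) (map \<alpha> zs)"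
proof -
  have "c (\<alpha> y # \<alpha> z # map \<alpha> zs) = \<beta> (c (y # z # zs))" for y z zs
    using c_equiv[of "y # z # zs"] by simp
  moreover have "p (\<alpha> (\<alpha> x)) (\<alpha> y # map \<alpha> zs) = \<beta> (p (\<alpha> x) (y # zs))" for y zs
    using p_equiv[OF \<alpha>_mem[OF x], of "y # zs"] by simp
  ultimately show ?thesis
    using c_equiv_Cons
    by (simp add: diff_p_def \<beta>_add \<beta>_pick_sum \<beta>_pick2_sum pick_sum_map pick2_sum_map p_equiv[OF x]
      act_mult[symmetric] funpow_swap1 \<alpha>_mult[symmetric] \<alpha>_s[OF x, symmetric] del: map_map)
qed

text \<open>In the expansion of the left-hand side, every summand with only \<open>x\<close> or only \<open>y\<close> occurs twice;
  the mixed summands are those of \<open>diff_c\<close>.\<close>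

lemma diff_p_add:
  assumes x: "x \<in> G 1" and y: "y \<in> G 1"
  shows "diff_p k c p (x + y) zs + diff_p k c p x zs + diff_p k c p y zs
    = diff_c k c (x # y # zs)"
proof -
  note lin = sym_alternating_linear[OF c_alternating] sym_alternating_linear2[OF c_alternating]
  have rotate: "c (\<alpha> x # \<alpha> y # br a b # zs) = c (br a b # \<alpha> x # \<alpha> y # zs)" for a b zs
    by (rule sym_alternating_rotate[OF c_alternating, symmetric])
  show ?thesis
    by (simp add: diff_p_def diff_c_Cons lin rotate pow_\<alpha>_add \<alpha>_add br_add_left act_add_left
        act_add_right s_add[OF x y] p_add[OF x y] p_add[OF \<alpha>_mem[OF x] \<alpha>_mem[OF y]]
        pick_sum_add pick2_sum_add ac_simps char2_m char2_m_left)
qed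

lemma is_cochain_diff:
  assumes "n \<ge> 1"
  shows "is_cochain (Suc n) (diff n (c, p))"
  unfolding is_cochain_def diff_def fst_conv snd_conv
proof (intro conjI ballI allI impI)
  show "sym_alternating sg sm (Suc n) (diff_c (n - 1) c)"
    by (rule sym_alternating_diff_c[OF c_alternating])
  show "\<beta> (diff_c (n - 1) c zs) = diff_c (n - 1) c (map \<alpha> zs)" for zs
    by (rule diff_c_equiv)
qed (use assms sym_alternating_diff_p in \<open>auto simp: G_scale diff_p_scale \<alpha>_mem diff_p_equiv G_add
      diff_p_add[simplified add.assoc] add.assoc numeral_2_eq_2\<close>)

lemma diff_diff_pair:
  assumes "n \<ge> 1"
  shows "diff (Suc n) (diff n (c, p)) = 0"
proof -
  have n: "n = Suc (n - 1)"
    using assms by simp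
  have "diff_c n (diff_c (n - 1) c) zs = 0" for zs
    by (subst n, rule diff_c_squared)
      (auto simp: sym_alternating_linear[OF c_alternating] c_equiv
        intro: sym_alternating_swap[OF c_alternating])
  moreover have "diff_p n (diff_c (n - 1) c)
      (\<lambda>x. if x \<in> G 1 then diff_p (n - 1) c p x else 0) x zs = 0" if x: "x \<in> G 1" for x zs
  proof -
    have "diff_p n (diff_c (n - 1) c) (\<lambda>x. if x \<in> G 1 then diff_p (n - 1) c p x else 0) x zs
      = diff_p n (diff_c (n - 1) c) (diff_p (n - 1) c p) x zs"
      using x by (simp add: diff_p_def[of n] \<alpha>_mem)
    also have "\<dots> = 0"
      by (subst n, rule diff_p_squared)
        (auto simp: x sym_alternating_perm_invariant[OF c_alternating]
          sym_alternating_linear[OF c_alternating]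
          sym_alternating_linear[OF p_alternating] c_equiv p_equiv
          intro: sym_alternating_swap[OF p_alternating])
    finally show ?thesis .
  qed
  ultimately show ?thesis
    unfolding diff_def fst_conv snd_conv diff_Suc_1 by (simp add: prod_eq_iff fun_eq_iff)
qed

end

lemma sym_alternating_0: "sym_alternating sg sm n (\<lambda>zs. 0)"
  by (rule sym_alternatingI) (simp_all add: perm_invariant_const)

lemma is_cochain_0: "is_cochain n 0"
proof -
  have "sym_alternating sg sm k 0" for k
    using sym_alternating_0 by (simp add: lambda_zero)
  then show ?thesis
    by (simp add: is_cochain_def \<beta>_zero)
qed

lemma sym_alternating_add:
  assumes "sym_alternating sg sm n f" "sym_alternating sg sm n g"
  shows "sym_alternating sg sm n (f + g)"
  unfolding plus_fun_def
proof (rule sym_alternatingI)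
  show "perm_invariant (\<lambda>zs. f zs + g zs)"
    by (rule perm_invariant_add[OF assms[THEN sym_alternating_perm_invariant]])
qed (simp_all add: assms[THEN sym_alternating_length] assms[THEN sym_alternating_linear(1)]
      assms[THEN sym_alternating_linear(2)] assms[THEN sym_alternating_not_distinct]
      M.scale_right_distrib ac_simps)

lemma sym_alternating_scale:
  assumes "sym_alternating sg sm n f"
  shows "sym_alternating sg sm n (\<lambda>zs. sm a (f zs))"
proof (rule sym_alternatingI)
  show "perm_invariant (\<lambda>zs. sm a (f zs))"
    by (rule perm_invariant_comp[OF sym_alternating_perm_invariant[OF assms]])
  show "sm a (f ((x + y) # zs)) = sm a (f (x # zs)) + sm a (f (y # zs))" for x y zs
    by (simp only: sym_alternating_linear(1)[OF assms] M.scale_right_distrib)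
  show "sm a (f (sg b x # zs)) = sm b (sm a (f (x # zs)))" for b x zs
    by (simp only: sym_alternating_linear(2)[OF assms] M.scale_left_commute[of a b])
qed (simp_all add: sym_alternating_length[OF assms] sym_alternating_not_distinct[OF assms])

lemma is_cochain_add:
  assumes "is_cochain n f" "is_cochain n g"
  shows "is_cochain n (f + g)"
proof -
  have "snd f (x + y) zs + snd g (x + y) zs + (snd f x zs + snd g x zs) + (snd f y zs + snd g y zs)
      = fst f (x # y # zs) + fst g (x # y # zs)" if "x \<in> G 1" "y \<in> G 1" for x y zs
  proof -
    have "snd f (x + y) zs + snd f x zs + snd f y zs = fst f (x # y # zs)"
      "snd g (x + y) zs + snd g x zs + snd g y zs = fst g (x # y # zs)"
      using assms that by (auto simp: is_cochain_def)
    then have "(snd f (x + y) zs + snd f x zs + snd f y zs)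
        + (snd g (x + y) zs + snd g x zs + snd g y zs) = fst f (x # y # zs) + fst g (x # y # zs)"
      by (simp only:)
    then show ?thesis
      by (simp only: ac_simps)
  qed
  then show ?thesis
    using assms by (simp add: is_cochain_def sym_alternating_add \<beta>_add M.scale_right_distrib)
qed

lemma is_cochain_scale:
  assumes "is_cochain n f"
  shows "is_cochain n (scale_cochain sm a f)"
proof -
  have "sm a (snd f (x + y) zs) + sm a (snd f x zs) + sm a (snd f y zs)
      = sm a (fst f (x # y # zs))" if "x \<in> G 1" "y \<in> G 1" for x y zs
  proof -
    have "snd f (x + y) zs + snd f x zs + snd f y zs = fst f (x # y # zs)"
      using assms that by (auto simp: is_cochain_def)
    then show ?thesis
      by (simp flip: M.scale_right_distrib)
  qed
  then show ?thesis
    using assms by (simp add: is_cochain_def scale_cochain_def sym_alternating_scale \<beta>_scale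
        mult.commute lambda_zero)
qed

lemma diff_add: "diff n (f + g) = diff n f + diff n g"
  by (auto simp: diff_def prod_eq_iff fun_eq_iff diff_c_def diff_p_def act_add_right pick_sum_add
      pick2_sum_add ac_simps)

lemma diff_scale: "diff n (scale_cochain sm a f) = scale_cochain sm a (diff n f)"
  by (auto simp: diff_def scale_cochain_def fun_eq_iff diff_c_def diff_p_def act_scale_right
      scale_pick_sum scale_pick2_sum M.scale_right_distrib)

section \<open>The cochain complex\<close>

text \<open>The equivariance and polarization conditions in \<open>XC_ge2\<close> are restricted to lists of the right
  length; on all other lists both sides of each condition are \<open>0\<close>.\<close>

lemma XC_ge2_iff:
  assumes "n \<ge> 2"
  shows "f \<in> XC_ge2 n \<longleftrightarrow> is_cochain n f"
proof -
  obtain c p where f: "f = (c, p)"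
    by (cases f)
  show ?thesis
  proof
    assume XC: "f \<in> XC_ge2 n"
    then have len: "c zs = 0" if "length zs \<noteq> n" for zs
      using that by (simp add: f XC_ge2_def alternating_map_def)
    have plen: "p x zs = 0" if "length zs \<noteq> n - 2" "x \<in> G 1" for x zs
      using that XC by (simp add: f XC_ge2_def alternating_map_def)
    have "\<beta> (c zs) = c (map \<alpha> zs)" for zs
      using XC len[of zs] len[of "map \<alpha> zs"]
      by (cases "length zs = n") (auto simp: f XC_ge2_def \<beta>_zero)
    moreover have "\<beta> (p x zs) = p (\<alpha> x) (map \<alpha> zs)" if "x \<in> G 1" for x zs
      using XC plen[of zs x] plen[of "map \<alpha> zs" "\<alpha> x"] that \<alpha>_mem[of x 1]
      by (cases "length zs = n - 2") (auto simp: f XC_ge2_def \<beta>_zero)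
    moreover have "p (x + y) zs + p x zs + p y zs = c (x # y # zs)"
      if "x \<in> G 1" "y \<in> G 1" for x y zs
      using XC plen[of zs] len[of "x # y # zs"] that G_add[of x 1 y] assms
      by (cases "length zs = n - 2") (auto simp: f XC_ge2_def)
    ultimately show "is_cochain n f"
      using XC assms by (auto simp: is_cochain_def f XC_ge2_def alternating_map_iff)
  next
    assume "is_cochain n f"
    then show "f \<in> XC_ge2 n"
      by (auto simp: is_cochain_def f XC_ge2_def alternating_map_iff)
  qed
qed

lemma XC1_iff: "f \<in> cochain1 ` XC1 \<longleftrightarrow> is_cochain 1 f"
proof
  assume "f \<in> cochain1 ` XC1"
  then obtain c where c: "Vector_Spaces.linear sg sm c" "\<beta> \<circ> c = c \<circ> \<alpha>" "f = cochain1 c"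
    by (auto simp: XC1_def)
  have "\<beta> (c x) = c (\<alpha> x)" for x
    using c(2) by (simp add: fun_eq_iff)
  moreover have "sym_alternating sg sm 1 (fst f)"
    using c(1) by (intro sym_alternatingI)
      (auto simp: c(3) cochain1_def Vector_Spaces.linear_iff perm_invariant_def)
  moreover have "sym_alternating sg sm 0 0"
    using sym_alternating_0 by (simp add: lambda_zero)
  ultimately show "is_cochain 1 f"
    by (auto simp: is_cochain_def c(3) cochain1_def \<beta>_zero)
next
  assume f: "is_cochain 1 f"
  have "fst f zs = fst (cochain1 (\<lambda>x. fst f [x])) zs" for zs
    using f by (cases zs rule: list.exhaust)
      (auto simp: cochain1_def is_cochain_def sym_alternating_def)
  then have "fst f = fst (cochain1 (\<lambda>x. fst f [x]))"
    by (rule ext)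
  moreover have "snd f = snd (cochain1 (\<lambda>x. fst f [x]))"
    using f by (simp add: cochain1_def is_cochain_def)
  ultimately have "f = cochain1 (\<lambda>x. fst f [x])"
    by (rule prod_eqI)
  moreover have "(\<lambda>x. fst f [x]) \<in> XC1"
    using f by (auto simp: XC1_def is_cochain_def sym_alternating_def fun_eq_iff)
  ultimately show "f \<in> cochain1 ` XC1"
    by blast
qed

lemma XC_iff: "n \<ge> 1 \<Longrightarrow> f \<in> XC n \<longleftrightarrow> is_cochain (nat n) f"
  using XC_ge2_iff[of "nat n" f] XC1_iff[of f] by (cases "n = 1") (auto simp: XC_def)

lemma d_ge2_eq_diff:
  assumes f: "is_cochain n f"
  shows "d_ge2 n f = diff n f"
proof -
  obtain c p where cp: "f = (c, p)"
    by (cases f)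
  note cochain = f[unfolded cp]
  have "fst (d_ge2 n f) zs = fst (diff n f) zs" for zs
  proof (cases "length zs = n + 1")
    case True
    then show ?thesis
      using sum_omit_eq_pick_sum[of "\<lambda>z ws. (\<alpha> ^^ (n - 1)) z \<bullet> c ws" zs]
        sum_omit2_eq_pick2_sum[of "\<lambda>a b ws. c (br a b # map \<alpha> ws)" zs]
      by (simp add: d_ge2_def diff_def diff_c_def cp del: sum.lessThan_Suc)
  next
    case False
    then show ?thesis
      using diff_c_length[OF c_alternating[OF cochain]] by (simp add: d_ge2_def diff_def cp)
  qed
  moreover have "snd (d_ge2 n f) x zs = snd (diff n f) x zs" for x zs
  proof (cases "x \<in> G 1 \<and> length zs = n - 1")
    case True
    then show ?thesis
      using sum_omit_eq_pick_sum[of "\<lambda>z ws. (\<alpha> ^^ (n - 1)) z \<bullet> p x ws" zs]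
        sum_omit_eq_pick_sum[of "\<lambda>z ws. c (br x z # \<alpha> x # map \<alpha> ws)" zs]
        sum_omit2_eq_pick2_sum[of "\<lambda>a b ws. p (\<alpha> x) (br a b # map \<alpha> ws)" zs]
      by (simp add: d_ge2_def diff_def diff_p_def cp)
  next
    case False
    then show ?thesis
      using diff_p_length[OF cochain, of x zs] by (auto simp: d_ge2_def diff_def cp)
  qed
  ultimately show ?thesis
    by (simp add: prod_eq_iff fun_eq_iff)
qed

lemma d1_eq_diff:
  assumes f: "is_cochain 1 f"
  shows "d1 (\<lambda>x. fst f [x]) = diff 1 f"
proof -
  obtain c p where cp: "f = (c, p)"
    by (cases f)
  note cochain = f[unfolded cp]
  have p: "p = 0"
    using cochain by (simp add: is_cochain_def)
  have "fst (d1 (\<lambda>x. fst f [x])) zs = fst (diff 1 f) zs" for zs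
  proof (cases "length zs = 2")
    case True
    then obtain x y where "zs = [x, y]"
      by (auto simp: length_Suc_conv numeral_2_eq_2)
    then show ?thesis
      by (simp add: d1_def diff_def diff_c_def cp ac_simps)
  next
    case False
    then show ?thesis
      using diff_c_length[OF c_alternating[OF cochain]] by (simp add: d1_def diff_def cp)
  qed
  moreover have "snd (d1 (\<lambda>x. fst f [x])) x zs = snd (diff 1 f) x zs" for x zs
  proof (cases "x \<in> G 1 \<and> zs = []")
    case True
    then show ?thesis
      by (simp add: d1_def diff_def diff_p_def cp add.commute)
  next
    case False
    then show ?thesis
      using diff_p_length[OF cochain, of x zs] by (auto simp: d1_def diff_def cp)
  qed
  ultimately show ?thesis
    by (simp add: prod_eq_iff fun_eq_iff)
qed

lemma d_eq_diff:
  assumes "n \<ge> 1" "is_cochain (nat n) f"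
  shows "d n f = diff (nat n) f"
  using assms d1_eq_diff[of f] d_ge2_eq_diff[of "nat n" f] by (cases "n = 1") (auto simp: d_def)

lemma d0_cochain0: "d 0 (cochain0 m) = cochain1 (d0 m)"
  by (simp add: d_def cochain0_def)

lemma d0_mem: "m \<in> XC0 \<Longrightarrow> d0 m \<in> XC1"
  using act_add_left act_scale_left act_mult[of _ m] vector_space_axioms M.vector_space_axioms
  by (auto simp: XC0_def XC1_def d0_def Vector_Spaces.linear_iff fun_eq_iff)

lemma d_d_0:
  assumes "m \<in> XC0"
  shows "d 1 (d 0 (cochain0 m)) = 0"
proof -
  have m: "\<beta> m = m" "\<alpha> x \<bullet> y \<bullet> m = x \<bullet> y \<bullet> m" for x y
    using assms by (auto simp: XC0_def)
  have "br x y \<bullet> m = x \<bullet> y \<bullet> m + y \<bullet> x \<bullet> m" for x y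
    using act_br[of x y m] by (simp add: m)
  moreover have "s x \<bullet> m = x \<bullet> x \<bullet> m" if "x \<in> G 1" for x
    using act_s[OF that, of m] by (simp add: m)
  ultimately show ?thesis
    unfolding d0_cochain0
    by (auto simp: d_def d1_def d0_def cochain1_def prod_eq_iff fun_eq_iff ac_simps char2_m
        char2_m_left)
qed

lemma XC0_0: "0 \<in> XC0"
  by (simp add: XC0_def \<beta>_zero act_zero_right)

lemma XC0_add: "m \<in> XC0 \<Longrightarrow> m' \<in> XC0 \<Longrightarrow> m + m' \<in> XC0"
  by (simp add: XC0_def \<beta>_add act_add_right)

lemma XC0_scale: "m \<in> XC0 \<Longrightarrow> sm a m \<in> XC0"
  by (simp add: XC0_def \<beta>_scale act_scale_right)

lemma cochain0_0: "cochain0 (0::'m) = (0 :: ('g, 'm) cochain)"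
  by (auto simp: cochain0_def prod_eq_iff fun_eq_iff)

lemma cochain0_add: "cochain0 (m + m') = (cochain0 m + cochain0 m' :: ('g, 'm) cochain)"
  by (auto simp: cochain0_def prod_eq_iff fun_eq_iff)

lemma cochain0_scale:
  "cochain0 (sm a m) = (scale_cochain sm a (cochain0 m) :: ('g, 'm) cochain)"
  by (auto simp: cochain0_def scale_cochain_def fun_eq_iff)

lemma scale_cochain_0: "scale_cochain sm a 0 = (0 :: ('g, 'm) cochain)"
  by (simp add: scale_cochain_def prod_eq_iff fun_eq_iff)

lemma XC_cases:
  obtains "n < 0" "XC n = {0}" "\<And>f. d n f = 0"
  | "n = 0" "XC n = cochain0 ` XC0"
  | "n \<ge> 1" "XC n = Collect (is_cochain (nat n))"
proof -
  consider "n < 0" | "n = 0" | "n \<ge> 1"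
    by linarith
  then show ?thesis
  proof cases
    case 3
    then show ?thesis
      using that XC_iff[of n] by blast
  qed (use that in \<open>auto simp: XC_def d_def\<close>)
qed

lemma XC_0: "0 \<in> XC n"
  by (cases n rule: XC_cases) (use XC0_0 cochain0_0 in \<open>auto simp: is_cochain_0 image_iff\<close>)

lemma XC_add: "f \<in> XC n \<Longrightarrow> g \<in> XC n \<Longrightarrow> f + g \<in> XC n"
  by (cases n rule: XC_cases) (auto simp: is_cochain_add XC0_add simp flip: cochain0_add)

lemma XC_scale: "f \<in> XC n \<Longrightarrow> scale_cochain sm a f \<in> XC n"
  by (cases n rule: XC_cases)
    (auto simp: is_cochain_scale XC0_scale scale_cochain_0 simp flip: cochain0_scale)

lemma d_mem:
  assumes "f \<in> XC n"
  shows "d n f \<in> XC (n + 1)"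
proof (cases n rule: XC_cases)
  case 1
  then show ?thesis
    by (simp add: XC_0)
next
  case 2
  then show ?thesis
    using assms d0_mem by (auto simp: d0_cochain0 XC_def)
next
  case 3
  then show ?thesis
    using assms is_cochain_diff[of "nat n" "fst f" "snd f"]
    by (simp add: XC_iff d_eq_diff nat_add_distrib)
qed

lemma d_d:
  assumes "f \<in> XC n"
  shows "d (n + 1) (d n f) = 0"
proof (cases n rule: XC_cases)
  case 1
  have "d (n + 1) 0 = 0" if "n < 0"
    using that by (auto simp: d_def d0_def cochain1_def act_zero_right prod_eq_iff fun_eq_iff)
  then show ?thesis
    using 1 by simp
next
  case 2
  then show ?thesis
    using assms d_d_0 by auto
next
  case 3
  then have "d (n + 1) (d n f) = diff (Suc (nat n)) (diff (nat n) f)"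
    using assms is_cochain_diff[of "nat n" "fst f" "snd f"]
    by (simp add: d_eq_diff nat_add_distrib)
  then show ?thesis
    using 3 assms diff_diff_pair[of "nat n" "fst f" "snd f"] by simp
qed

lemma d_add:
  assumes "f \<in> XC n" "g \<in> XC n"
  shows "d n (f + g) = d n f + d n g"
proof (cases n rule: XC_cases)
  case 2
  then obtain m m' where m: "f = cochain0 m" "g = cochain0 m'"
    using assms by auto
  show ?thesis
    unfolding m 2 cochain0_add[symmetric] d0_cochain0
    by (simp add: cochain1_def d0_def act_add_right prod_eq_iff fun_eq_iff)
qed (use assms in \<open>simp_all add: d_eq_diff is_cochain_add diff_add\<close>)

lemma d_scale:
  assumes "f \<in> XC n"
  shows "d n (scale_cochain sm a f) = scale_cochain sm a (d n f)"
proof (cases n rule: XC_cases)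
  case 2
  then obtain m where m: "f = cochain0 m"
    using assms by auto
  show ?thesis
    unfolding m 2 cochain0_scale[symmetric] d0_cochain0
    by (simp add: cochain1_def d0_def act_scale_right scale_cochain_def prod_eq_iff fun_eq_iff)
qed (use assms in \<open>simp_all add: d_eq_diff is_cochain_scale diff_scale scale_cochain_0\<close>)

lemma vector_space_cochain:
  "vector_space (scale_cochain sm :: 'k \<Rightarrow> ('g, 'm) cochain \<Rightarrow> ('g, 'm) cochain)"
  by unfold_locales
    (auto simp: scale_cochain_def prod_eq_iff fun_eq_iff M.scale_right_distrib
      M.scale_left_distrib)

lemma cochain_complex_XC: "cochain_complex (scale_cochain sm) XC d"
proof -
  interpret C: vector_space "scale_cochain sm :: 'k \<Rightarrow> ('g, 'm) cochain \<Rightarrow> ('g, 'm) cochain"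
    by (rule vector_space_cochain)
  show ?thesis
    by unfold_locales
      (auto simp: C.subspace_def XC_0 XC_add XC_scale d_mem d_add d_scale d_d)
qed

end

theorem theorem6p4:
  fixes sg :: "'k::field \<Rightarrow> 'g::ab_group_add \<Rightarrow> 'g"
    and G :: "bit \<Rightarrow> 'g set"
    and br :: "'g \<Rightarrow> 'g \<Rightarrow> 'g"
    and s \<alpha> :: "'g \<Rightarrow> 'g"
    and sm :: "'k \<Rightarrow> 'm::ab_group_add \<Rightarrow> 'm"
    and M :: "bit \<Rightarrow> 'm set"
    and act :: "'g \<Rightarrow> 'm \<Rightarrow> 'm"
    and \<beta> :: "'m \<Rightarrow> 'm"
  assumes "hom_lie_superalgebra_char2 sg G br s \<alpha>"
    and "hom_lie_module_char2 sg G br s \<alpha> sm M act \<beta>"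
  shows "let XC = hom_lie_module_char2.XC sg G \<alpha> sm act \<beta>;
             d = hom_lie_module_char2.d G br s \<alpha> act
         in (\<forall>n\<ge>1. \<forall>f \<in> XC (n - 1). (d n \<circ> d (n - 1)) f = 0) \<and>
            cochain_complex (scale_cochain sm) XC d"
proof -
  interpret hom_lie_module_char2 sg G br s \<alpha> sm M act \<beta>
    by (rule assms(2))
  have "d n (d (n - 1) f) = 0" if "f \<in> XC (n - 1)" for n f
    using d_d[OF that] by simp
  then show ?thesis
    using cochain_complex_XC by simp
qed

end
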